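(* Let $M$ be a finitely presented special monoid with virtually free group of units. Then the rational subset membership problem for $M$ is decidable.
   Context: A monoid is special if it admits a monoid presentation in which every defining relation is of the form $w=1$; a finitely presented special monoid is one given by a finite presentation $\langle A \mid w_1=1,\dots,w_k=1\rangle$ (with $A$ finite). The group of units is the group of all two-sided invertible elements of $M$. Let $\pi\colon A^*\to M$ be the canonical surjective homomorphism. A subset of $M$ is rational if it is of the form $\pi(L)$ for a regular language $L\subseteq A^*$. The rational subset membership problem for $M$ is decidable if there is an algorithm which, given as input a word $w\in A^*$ and a regular language $K\subseteq A^*$ (given e.g. by a finite-state automaton accepting it), decides whether $\pi(w)\in\pi(K)$. *)

theory Defs
  imports "HOL-Algebra.Coset" "HOL-Library.Nat_Bijection"
begin

section \<open>Monoid presentations\<close>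

inductive_set pres_cong :: "'a set \<Rightarrow> ('a list \<times> 'a list) set \<Rightarrow> ('a list \<times> 'a list) set"
  for A :: "'a set" and R :: "('a list \<times> 'a list) set"
  where
    rel: "\<lbrakk>(u, v) \<in> R; u \<in> lists A; v \<in> lists A; x \<in> lists A; y \<in> lists A\<rbrakk>
      \<Longrightarrow> (x @ u @ y, x @ v @ y) \<in> pres_cong A R"
  | refl: "w \<in> lists A \<Longrightarrow> (w, w) \<in> pres_cong A R"
  | sym: "(u, v) \<in> pres_cong A R \<Longrightarrow> (v, u) \<in> pres_cong A R"
  | trans: "\<lbrakk>(u, v) \<in> pres_cong A R; (v, w) \<in> pres_cong A R\<rbrakk> \<Longrightarrow> (u, w) \<in> pres_cong A R"

definition presented_monoid ::
  "'a set \<Rightarrow> ('a list \<times> 'a list) set \<Rightarrow> 'a list set monoid" where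
  "presented_monoid A R =
     \<lparr>carrier = lists A // pres_cong A R,
      mult = (\<lambda>X Y. \<Union>x\<in>X. \<Union>y\<in>Y. pres_cong A R `` {x @ y}),
      one = pres_cong A R `` {[]}\<rparr>"

definition canonical :: "'a set \<Rightarrow> ('a list \<times> 'a list) set \<Rightarrow> 'a list \<Rightarrow> 'a list set" where
  "canonical A R w = pres_cong A R `` {w}"

definition special_rels :: "'a list set \<Rightarrow> ('a list \<times> 'a list) set" where
  "special_rels W = {(w, []) |w. w \<in> W}"

lemma pres_cong_lists: "(u, v) \<in> pres_cong A R \<Longrightarrow> u \<in> lists A \<and> v \<in> lists A"
  by (induction rule: pres_cong.induct) auto

lemma equiv_pres_cong: "equiv (lists A) (pres_cong A R)"
  by (rule equivI)
    (auto simp: refl_on_def sym_def trans_def intro: pres_cong.intros dest: pres_cong_lists)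

lemma pres_cong_append:
  assumes "(u, v) \<in> pres_cong A R" "x \<in> lists A" "y \<in> lists A"
  shows "(x @ u @ y, x @ v @ y) \<in> pres_cong A R"
  using assms
proof (induction rule: pres_cong.induct)
  case (rel u v x' y')
  then have "((x @ x') @ u @ (y' @ y), (x @ x') @ v @ (y' @ y)) \<in> pres_cong A R"
    by (intro pres_cong.rel) auto
  then show ?case by simp
next
  case (refl w)
  then show ?case by (intro pres_cong.refl) auto
next
  case (sym u v)
  then show ?case by (auto intro: pres_cong.sym)
next
  case (trans u v w)
  then show ?case by (blast intro: pres_cong.trans)
qed

lemma congruent2_pres_cong:
  "congruent2 (pres_cong A R) (pres_cong A R) (\<lambda>x y. pres_cong A R `` {x @ y})"
proof (rule congruent2I')
  fix x x' y y' assume h: "(x, x') \<in> pres_cong A R" "(y, y') \<in> pres_cong A R"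
  then have "x \<in> lists A" "x' \<in> lists A" "y \<in> lists A" "y' \<in> lists A"
    by (auto dest: pres_cong_lists)
  then have "(x @ y, x' @ y) \<in> pres_cong A R" "(x' @ y, x' @ y') \<in> pres_cong A R"
    using pres_cong_append[OF h(1), of "[]" y] pres_cong_append[OF h(2), of x' "[]"] by auto
  then show "pres_cong A R `` {x @ y} = pres_cong A R `` {x' @ y'}"
    by (meson equiv_class_eq equiv_pres_cong pres_cong.trans)
qed

lemma canonical_append:
  assumes "u \<in> lists A" "v \<in> lists A"
  shows "canonical A R (u @ v) = canonical A R u \<otimes>\<^bsub>presented_monoid A R\<^esub> canonical A R v"
  using UN_equiv_class2[OF equiv_pres_cong equiv_pres_cong congruent2_pres_cong assms]
  by (simp add: canonical_def presented_monoid_def)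

lemma canonical_image: "canonical A R ` lists A = carrier (presented_monoid A R)"
  by (auto simp: canonical_def presented_monoid_def quotient_def)

lemma canonical_Nil: "canonical A R [] = \<one>\<^bsub>presented_monoid A R\<^esub>"
  by (simp add: canonical_def presented_monoid_def)

lemma monoid_presented_monoid: "monoid (presented_monoid A R)"
proof (rule monoidI)
  fix X Y Z
  assume "X \<in> carrier (presented_monoid A R)" "Y \<in> carrier (presented_monoid A R)"
    "Z \<in> carrier (presented_monoid A R)"
  then obtain x y z where "x \<in> lists A" "X = canonical A R x" "y \<in> lists A" "Y = canonical A R y"
    "z \<in> lists A" "Z = canonical A R z"
    unfolding canonical_image[symmetric] by blast
  then show "X \<otimes>\<^bsub>presented_monoid A R\<^esub> Y \<in> carrier (presented_monoid A R)"
    "X \<otimes>\<^bsub>presented_monoid A R\<^esub> Y \<otimes>\<^bsub>presented_monoid A R\<^esub> Z =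
      X \<otimes>\<^bsub>presented_monoid A R\<^esub> (Y \<otimes>\<^bsub>presented_monoid A R\<^esub> Z)"
    "\<one>\<^bsub>presented_monoid A R\<^esub> \<otimes>\<^bsub>presented_monoid A R\<^esub> X = X"
    "X \<otimes>\<^bsub>presented_monoid A R\<^esub> \<one>\<^bsub>presented_monoid A R\<^esub> = X"
    by (auto simp flip: canonical_append canonical_image canonical_Nil)
next
  show "\<one>\<^bsub>presented_monoid A R\<^esub> \<in> carrier (presented_monoid A R)"
    by (auto simp flip: canonical_image canonical_Nil)
qed


section \<open>Virtually free groups\<close>

text \<open>The free group on \<open>X\<close>: words over \<open>X\<close> and formal inverses modulo free
  reduction, \<open>(x, True)\<close> standing for \<open>x\<close> and \<open>(x, False)\<close> for its inverse.\<close>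

definition free_group :: "'x set \<Rightarrow> ('x \<times> bool) list set monoid" where
  "free_group X = presented_monoid (X \<times> UNIV) (special_rels {[(x, b), (x, \<not> b)] |x b. x \<in> X})"

text \<open>Taking \<open>X\<close> inside the element type of \<open>G\<close> loses nothing, since a basis of a free
  group embeds in the group.\<close>

definition is_free_group :: "('g, 'm) monoid_scheme \<Rightarrow> bool" where
  "is_free_group G \<longleftrightarrow> (\<exists>X :: 'g set. free_group X \<cong> G)"

definition virtually_free :: "('g, 'm) monoid_scheme \<Rightarrow> bool" where
  "virtually_free G \<longleftrightarrow>
     (\<exists>H. subgroup H G \<and> finite (rcosets\<^bsub>G\<^esub> H) \<and> is_free_group (G\<lparr>carrier := H\<rparr>))"


section \<open>Recursive functions\<close>

text \<open>\<open>recursive k f\<close>: \<open>f\<close>, restricted to argument lists of length \<open>k\<close>, is a total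
  recursive function of \<open>k\<close> arguments (minimisation is applied to regular functions only).
  The values of \<open>f\<close> on lists of other lengths carry no meaning.\<close>

inductive recursive :: "nat \<Rightarrow> (nat list \<Rightarrow> nat) \<Rightarrow> bool" where
  zero: "recursive k (\<lambda>xs. 0)"
| succ: "recursive 1 (\<lambda>xs. Suc (xs ! 0))"
| proj: "i < k \<Longrightarrow> recursive k (\<lambda>xs. xs ! i)"
| comp: "\<lbrakk>recursive (length gs) f; \<forall>g\<in>set gs. recursive k g\<rbrakk>
    \<Longrightarrow> recursive k (\<lambda>xs. f (map (\<lambda>g. g xs) gs))"
| prec: "\<lbrakk>recursive k f; recursive (Suc (Suc k)) g\<rbrakk>
    \<Longrightarrow> recursive (Suc k) (\<lambda>xs. rec_nat (f (tl xs)) (\<lambda>n r. g (n # r # tl xs)) (hd xs))"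
| mini: "\<lbrakk>recursive (Suc k) f; \<forall>xs. length xs = k \<longrightarrow> (\<exists>n. f (n # xs) = 0)\<rbrakk>
    \<Longrightarrow> recursive k (\<lambda>xs. LEAST n. f (n # xs) = 0)"


section \<open>Finite automata\<close>

text \<open>States are natural numbers; the finite sets of transitions, initial states and final
  states are given by lists, so that an automaton is a finite object that can be coded.\<close>

datatype 'a nfa = NFA
  (transitions: "(nat \<times> 'a \<times> nat) list")
  (initials: "nat list")
  (finals: "nat list")

definition nfa_over :: "'a set \<Rightarrow> 'a nfa \<Rightarrow> bool" where
  "nfa_over A N \<longleftrightarrow> (\<forall>(p, a, q)\<in>set (transitions N). a \<in> A)"

inductive run :: "'a nfa \<Rightarrow> nat \<Rightarrow> 'a list \<Rightarrow> nat \<Rightarrow> bool" for N :: "'a nfa" where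
  Nil: "run N p [] p"
| Cons: "\<lbrakk>(p, a, q) \<in> set (transitions N); run N q w r\<rbrakk> \<Longrightarrow> run N p (a # w) r"

definition language :: "'a nfa \<Rightarrow> 'a list set" where
  "language N = {w. \<exists>p\<in>set (initials N). \<exists>q\<in>set (finals N). run N p w q}"


section \<open>The rational subset membership problem\<close>

text \<open>An injective numbering \<open>e\<close> of the alphabet turns words and automata into numbers.\<close>

definition word_code :: "('a \<Rightarrow> nat) \<Rightarrow> 'a list \<Rightarrow> nat" where
  "word_code e w = list_encode (map e w)"

definition nfa_code :: "('a \<Rightarrow> nat) \<Rightarrow> 'a nfa \<Rightarrow> nat" where
  "nfa_code e N = prod_encode
     (list_encode (map (\<lambda>(p, a, q). prod_encode (p, prod_encode (e a, q))) (transitions N)),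
      prod_encode (list_encode (initials N), list_encode (finals N)))"

text \<open>The alphabet being finite, any two numberings differ by a computable translation, so
  requiring decidability for all of them is the same as requiring it for one.\<close>

definition rational_subset_membership_decidable ::
  "'a set \<Rightarrow> ('a list \<times> 'a list) set \<Rightarrow> bool" where
  "rational_subset_membership_decidable A R \<longleftrightarrow>
     (\<forall>e. inj_on e A \<longrightarrow>
       (\<exists>f. recursive 2 f \<and>
         (\<forall>w\<in>lists A. \<forall>K. nfa_over A K \<longrightarrow>
           f [word_code e w, nfa_code e K] =
             (if canonical A R w \<in> canonical A R ` language K then 1 else 0))))"

end

(* Write u ~ v for equality in M. For words u = h a r and v = h' a' r' that are not invertible, let
   h, h' be their longest invertible prefixes. Then u ~ v holds exactly if h ~ h', a = a' and r ~ r': this survives the insertion of a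
   relator, because a prefix of a relator that is a suffix of an invertible word is invertible.
   So equality in M is equality of units, level by level. Every invertible word is a product of primes
   (invertible words without proper nonempty invertible prefix), and a prime a z satisfies z ~ z' for
   some a z' that is a letter or a factor of a relator. Hence the values of primes form a finite set S
   of units.

   In a virtually free group the path spelled by a word over S whose value is small passes close
   to the middle of the geodesic to its end (Cayley graph of a free group = tree), so that the word
   splits into two words with small values: there is a finite set B of units such that words over S
   and inverses with value in B split inside B. Together with the values of factors of relators this
   gives a finite subset Q of M such that each word of length at least 2 with value in Q is a product
   of two shorter nonempty words with values in Q.

   Consequently, that a suffix of the input word equals b in B times the label of a run from a state p
   to a final state is derivable by finitely many rules, whose other premises say that a factor of the
   input word, or the label of some path in the automaton, has a given value in Q. All these facts
   range over a finite set bounded in terms of the input, and membership holds iff every set of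
   facts closed under the rules contains the wanted one. Sets of facts are coded by numbers, so this is
   a bounded quantification over a primitive recursive predicate. *)

theory Submission
  imports Defs
begin

section \<open>Computable functions of variable assignments\<close>

text \<open>Functions of an assignment \<open>v\<close> of all variables, of which only finitely many are read.
  Binders are in de Bruijn style: a bound variable becomes \<open>v 0\<close> and the others are shifted.\<close>

definition computable :: "((nat \<Rightarrow> nat) \<Rightarrow> nat) \<Rightarrow> bool" where
  "computable F \<longleftrightarrow> (\<exists>k f. recursive k f \<and> (\<forall>v. F v = f (map v [0..<k])))"

abbreviation decid :: "((nat \<Rightarrow> nat) \<Rightarrow> bool) \<Rightarrow> bool" where
  "decid P \<equiv> computable (\<lambda>v. of_bool (P v))"

section \<open>Closure of the computable functions under composition, recursion and
  arithmetic\<close>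

lemma recursive_weaken:
  assumes "recursive k f" "k \<le> m"
  shows "recursive m (\<lambda>xs. f (map (\<lambda>i. xs ! i) [0..<k]))"
proof -
  have "recursive m (\<lambda>xs. f (map (\<lambda>g. g xs) (map (\<lambda>i xs. xs ! i) [0..<k])))"
    using assms by (intro recursive.comp) (auto intro: recursive.proj)
  then show ?thesis by (simp add: comp_def)
qed

text \<open>Composition and recursion need functions of one common arity. Every arity from some
  point on will do, since further variables can be added and left unread.\<close>

lemma computable_arity:
  assumes "computable F"
  obtains K where "\<And>k. K \<le> k \<Longrightarrow> \<exists>f. recursive k f \<and> (\<forall>v. F v = f (map v [0..<k]))"
proof -
  from assms obtain K f where f: "recursive K f" "\<And>v. F v = f (map v [0..<K])"
    by (auto simp: computable_def)
  show thesis
  proof (rule that[of K])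
    fix k assume k: "K \<le> k"
    have "F v = f (map (\<lambda>i. map v [0..<k] ! i) [0..<K])" for v
      unfolding f(2) using k by (intro arg_cong[where f = f]) auto
    then show "\<exists>f. recursive k f \<and> (\<forall>v. F v = f (map v [0..<k]))"
      using recursive_weaken[OF f(1) k] by blast
  qed
qed

lemma computable_common_arity:
  assumes "\<forall>F\<in>set Fs. computable F"
  shows "\<exists>K. \<forall>k\<ge>K. \<forall>F\<in>set Fs. \<exists>f. recursive k f \<and> (\<forall>v. F v = f (map v [0..<k]))"
  using assms
proof (induction Fs)
  case (Cons F Fs)
  then obtain K where K: "\<forall>k\<ge>K. \<forall>F\<in>set Fs. \<exists>f. recursive k f \<and> (\<forall>v. F v = f (map v [0..<k]))"
    by auto
  obtain L where L: "\<And>k. L \<le> k \<Longrightarrow> \<exists>f. recursive k f \<and> (\<forall>v. F v = f (map v [0..<k]))"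
    using Cons.prems computable_arity[of F] by (metis list.set_intros(1))
  show ?case
    using K L by (intro exI[of _ "max K L"]) auto
qed auto

lemma computable_comp:
  assumes f: "recursive (length Fs) f" and Fs: "\<forall>F\<in>set Fs. computable F"
  shows "computable (\<lambda>v. f (map (\<lambda>F. F v) Fs))"
proof -
  obtain k where "\<forall>F\<in>set Fs. \<exists>g. recursive k g \<and> (\<forall>v. F v = g (map v [0..<k]))"
    using computable_common_arity[OF Fs] by blast
  then obtain h where h: "\<And>F. F \<in> set Fs \<Longrightarrow> recursive k (h F)"
    "\<And>F v. F \<in> set Fs \<Longrightarrow> F v = h F (map v [0..<k])" by metis
  have "recursive k (\<lambda>xs. f (map (\<lambda>g. g xs) (map h Fs)))"
    using f h(1) by (intro recursive.comp) auto
  moreover have "f (map (\<lambda>F. F v) Fs) = f (map (\<lambda>g. g (map v [0..<k])) (map h Fs))" for v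
    using h(2)[of _ v] by (intro arg_cong[where f = f]) auto
  ultimately show ?thesis unfolding computable_def by blast
qed

lemma computable_var: "computable (\<lambda>v. v i)"
proof -
  have "recursive (Suc i) (\<lambda>xs. xs ! i)" by (intro recursive.proj) simp
  moreover have "v i = map v [0..<Suc i] ! i" for v :: "nat \<Rightarrow> nat" 
    by (simp del: upt_Suc)
  ultimately show ?thesis unfolding computable_def by blast
qed

lemma computable_Suc: "computable F \<Longrightarrow> computable (\<lambda>v. Suc (F v))"
  using computable_comp[of "[F]" "\<lambda>xs. Suc (xs ! 0)"] recursive.succ by simp

lemma computable_const: "computable (\<lambda>v. c)"
proof (induction c)
  case 0
  show ?case unfolding computable_def using recursive.zero[of 0] by blast
next
  case (Suc c)
  then show ?case by (rule computable_Suc)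
qed

lemma computable_rec:
  assumes "computable N" "computable F" "computable (\<lambda>v. G (v 0) (v (Suc 0)) (\<lambda>i. v (Suc (Suc i))))"
  shows "computable (\<lambda>v. rec_nat (F v) (\<lambda>n r. G n r v) (N v))"
proof -
  let ?G = "\<lambda>v. G (v 0) (v (Suc 0)) (\<lambda>i. v (Suc (Suc i)))"
  obtain K where K: "\<And>k. K \<le> k \<Longrightarrow> \<exists>f. recursive k f \<and> (\<forall>v. F v = f (map v [0..<k]))"
    using computable_arity[OF assms(2)] by blast
  obtain L where L: "\<And>k. L \<le> k \<Longrightarrow> \<exists>g. recursive k g \<and> (\<forall>v. ?G v = g (map v [0..<k]))"
    using computable_arity[OF assms(3)] by blast
  define k where "k = K + L"
  obtain f where f: "recursive k f" "\<And>v. F v = f (map v [0..<k])" using K[of k] by (auto simp: k_def)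
  obtain g where g: "recursive (Suc (Suc k)) g" "\<And>v. ?G v = g (map v [0..<Suc (Suc k)])"
    using L[of "Suc (Suc k)"] by (auto simp: k_def)
  have G: "G n r v = g (n # r # map v [0..<k])" for n r v
  proof -
    \<comment> \<open>The assignment with \<open>n\<close> and \<open>r\<close> put in front of
      \<open>v\<close>; at \<open>w\<close> the hypothesis on \<open>G\<close> speaks about
      \<open>G n r v\<close>.\<close>
    define w where "w i = (case i of 0 \<Rightarrow> n | Suc j \<Rightarrow> (case j of 0 \<Rightarrow> r | Suc l \<Rightarrow> v l))" for i
    have "?G w = g (map w [0..<Suc (Suc k)])" by (rule g(2))
    moreover have "?G w = G n r v" by (simp add: w_def)
    moreover have "map w [0..<Suc (Suc k)] = n # r # map v [0..<k]"
      by (simp add: w_def map_upt_Suc del: upt_Suc)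
    ultimately show ?thesis by simp
  qed
  have "recursive (Suc k) (\<lambda>xs. rec_nat (f (tl xs)) (\<lambda>n r. g (n # r # tl xs)) (hd xs))"
    by (intro recursive.prec f g)
  then have "computable (\<lambda>v. (\<lambda>xs. rec_nat (f (tl xs)) (\<lambda>n r. g (n # r # tl xs)) (hd xs))
      (map (\<lambda>F. F v) (N # map (\<lambda>i v. v i) [0..<k])))"
    by (intro computable_comp) (auto intro: assms computable_var)
  then show ?thesis by (simp add: comp_def f(2) G)
qed

lemma computable_subst:
  assumes "computable F" "\<And>i. computable (\<lambda>v. s v i)"
  shows "computable (\<lambda>v. F (s v))"
proof -
  obtain k f where f: "recursive k f" "\<And>v. F v = f (map v [0..<k])"
    using assms(1) by (auto simp: computable_def)
  have "computable (\<lambda>v. f (map (\<lambda>F. F v) (map (\<lambda>i v. s v i) [0..<k])))"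
    using f by (intro computable_comp) (auto intro: assms)
  then show ?thesis by (simp add: f(2) comp_def)
qed

lemma computable_add:
  assumes "computable F" "computable G" shows "computable (\<lambda>v. F v + G v)"
proof -
  have "rec_nat a (\<lambda>n r. Suc r) b = a + b" for a b by (induction b) auto
  moreover have "computable (\<lambda>v. rec_nat (F v) (\<lambda>n r. Suc r) (G v))"
    by (intro computable_rec computable_Suc computable_var assms)
  ultimately show ?thesis by simp
qed

lemma computable_mult:
  assumes "computable F" "computable G" shows "computable (\<lambda>v. F v * G v)"
proof -
  have "rec_nat 0 (\<lambda>n r. r + a) b = a * b" for a b :: nat by (induction b) auto
  moreover have "computable (\<lambda>v. rec_nat 0 (\<lambda>n r. r + F v) (G v))"
  proof (rule computable_rec[where G = "\<lambda>n r v. r + F v"])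
    have "computable (\<lambda>v. F (\<lambda>i. v (Suc (Suc i))))"
      by (intro computable_subst[OF assms(1)] computable_var)
    then show "computable (\<lambda>v. v (Suc 0) + F (\<lambda>i. v (Suc (Suc i))))"
      by (intro computable_add computable_var)
  qed (auto intro: assms computable_const)
  ultimately show ?thesis by simp
qed

lemma computable_pred:
  assumes "computable F" shows "computable (\<lambda>v. F v - 1)"
proof -
  have "rec_nat 0 (\<lambda>n r. n) b = b - 1" for b :: nat by (cases b) auto
  moreover have "computable (\<lambda>v. rec_nat 0 (\<lambda>n r. n) (F v))"
    by (intro computable_rec computable_const computable_var assms)
  ultimately show ?thesis by simp
qed

lemma computable_diff:
  assumes "computable F" "computable G" shows "computable (\<lambda>v. F v - G v)"
proof -
  have "rec_nat a (\<lambda>n r. r - 1) b = a - b" for a b :: nat by (induction b) auto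
  moreover have "computable (\<lambda>v. rec_nat (F v) (\<lambda>n r. r - 1) (G v))"
    by (intro computable_rec computable_var computable_pred assms)
  ultimately show ?thesis by simp
qed

section \<open>Decidable predicates, bounded quantifiers and minimisation\<close>

lemma decid_not: 
  assumes "decid P" shows "decid (\<lambda>v. \<not> P v)"
proof -
  have "computable (\<lambda>v. 1 - of_bool (P v))"
    by (intro computable_diff computable_const assms)
  moreover have "1 - of_bool b = (of_bool (\<not> b) :: nat)" for b by (cases b) auto
  ultimately show ?thesis by simp
qed

lemma decid_conj: 
  assumes "decid P" "decid Q" shows "decid (\<lambda>v. P v \<and> Q v)"
  using computable_mult[OF assms] by (simp only: of_bool_conj)

lemma decid_disj: 
  assumes "decid P" "decid Q" shows "decid (\<lambda>v. P v \<or> Q v)"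
  using decid_not[OF decid_conj[OF decid_not[OF assms(1)] decid_not[OF assms(2)]]]
  by (simp only: de_Morgan_conj not_not)

lemma decid_imp: 
  assumes "decid P" "decid Q" shows "decid (\<lambda>v. P v \<longrightarrow> Q v)"
  unfolding imp_conv_disj by (intro decid_disj decid_not assms)

lemma decid_le:
  assumes "computable F" "computable G" shows "decid (\<lambda>v. F v \<le> G v)"
proof -
  have "1 - (a - b) = of_bool (a \<le> b)" for a b :: nat by (cases "a \<le> b") simp_all
  moreover have "computable (\<lambda>v. 1 - (F v - G v))"
    by (intro computable_diff computable_const assms)
  ultimately show ?thesis by simp
qed

lemma decid_eq:
  assumes "computable F" "computable G" shows "decid (\<lambda>v. F v = G v)"
  unfolding order_eq_iff by (intro decid_conj decid_le assms)

text \<open>The search is a recursion up to the bound whose accumulated value records whether a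
  witness has occurred.\<close>

lemma decid_ex:
  assumes "computable N" "decid (\<lambda>v. P (v 0) (\<lambda>i. v (Suc i)))"
  shows "decid (\<lambda>v. \<exists>i<N v. P i v)"
proof -
  have *: "rec_nat 0 (\<lambda>n r. of_bool (r \<noteq> 0 \<or> P n v)) b = of_bool (\<exists>i<b. P i v)" for b v
  proof (induction b)
    case (Suc b)
    then show ?case by (cases "\<exists>i<b. P i v") (auto simp: less_Suc_eq)
  qed simp
  \<comment> \<open>Inside the recursion variable 1 holds the accumulated value, so the outer
    variables that \<open>P\<close> reads start at variable 2.\<close>
  have "decid (\<lambda>v. P (v 0) (\<lambda>i. v (Suc (Suc i))))"
  proof -
    have "computable (\<lambda>v. case i of 0 \<Rightarrow> v 0 | Suc j \<Rightarrow> v (Suc (Suc j)))" for i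
      by (cases i) (simp_all add: computable_var)
    from computable_subst[OF assms(2), where s = "\<lambda>v i. case i of 0 \<Rightarrow> v 0 | Suc j \<Rightarrow> v (Suc (Suc j))", OF this] 
    show ?thesis by simp
  qed
  then have "computable (\<lambda>v. rec_nat 0 (\<lambda>n r. of_bool (r \<noteq> 0 \<or> P n v)) (N v))"
    by (intro computable_rec computable_const decid_disj decid_not decid_eq computable_var assms)
  then show ?thesis unfolding * .
qed

lemma decid_all:
  assumes "computable N" "decid (\<lambda>v. P (v 0) (\<lambda>i. v (Suc i)))"
  shows "decid (\<lambda>v. \<forall>i<N v. P i v)"
  using decid_not[OF decid_ex[OF assms(1) decid_not[OF assms(2)]]] 
  by (simp only: not_ex de_Morgan_conj not_not imp_conv_disj)

lemma decid_Bex: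
  assumes "finite I" "\<And>i. i \<in> I \<Longrightarrow> decid (P i)"
  shows "decid (\<lambda>v. \<exists>i\<in>I. P i v)"
  using assms
proof (induction I rule: finite_induct)
  case empty
  show ?case by (simp add: computable_const)
next
  case (insert x F)
  then have "decid (\<lambda>v. P x v \<or> (\<exists>i\<in>F. P i v))"
    by (intro decid_disj) auto
  then show ?case by simp
qed

lemma decid_Ball:
  assumes "finite I" "\<And>i. i \<in> I \<Longrightarrow> decid (P i)"
  shows "decid (\<lambda>v. \<forall>i\<in>I. P i v)"
proof -
  have eq: "(\<forall>i\<in>I. P i v) \<longleftrightarrow> \<not> (\<exists>i\<in>I. \<not> P i v)" for v by blast
  show ?thesis unfolding eq by (intro decid_not decid_Bex assms)
qed

text \<open>Minimisation looks for a zero and is therefore applied to the indicator of the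
  negation.\<close>

lemma computable_Least:
  assumes P: "decid (\<lambda>v. P (v 0) (\<lambda>i. v (Suc i)))" and ex: "\<And>v. \<exists>n. P n v"
  shows "computable (\<lambda>v. LEAST n. P n v)"
proof -
  obtain K where K: "\<And>k. K \<le> k \<Longrightarrow> \<exists>f. recursive k f \<and>
      (\<forall>v. of_bool (\<not> P (v 0) (\<lambda>i. v (Suc i))) = f (map v [0..<k]))"
    using computable_arity[OF decid_not[OF P]] by blast
  obtain f where f: "recursive (Suc K) f"
    "\<And>v. of_bool (\<not> P (v 0) (\<lambda>i. v (Suc i))) = f (map v [0..<Suc K])" 
    using K[of "Suc K"] by auto
  have f': "f (n # map v [0..<K]) = of_bool (\<not> P n v)" for n v
    using f(2)[of "\<lambda>i. case i of 0 \<Rightarrow> n | Suc j \<Rightarrow> v j"] 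
    by (simp add: map_upt_Suc del: upt_Suc)
  have "recursive K (\<lambda>xs. LEAST n. f (n # xs) = 0)"
  proof (intro recursive.mini f(1) allI impI)
    fix xs :: "nat list" assume "length xs = K"
    \<comment> \<open>Every argument list of length \<open>K\<close> comes from an assignment, so
      the existence hypothesis makes the function regular.\<close>
    then have "xs = map (\<lambda>i. xs ! i) [0..<K]" by (metis map_nth)
    then show "\<exists>n. f (n # xs) = 0"
      using ex[of "\<lambda>i. xs ! i"] f'[of _ "\<lambda>i. xs ! i"] by (metis of_bool_eq(1))
  qed
  moreover have "(LEAST n. P n v) = (LEAST n. f (n # map v [0..<K]) = 0)" for v
    by (simp add: f')
  ultimately show ?thesis unfolding computable_def by blast
qed

section \<open>Pairs, finite sets and lists coded by numbers\<close>

lemma computable_power2: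
  assumes "computable F" shows "computable (\<lambda>v. 2 ^ F v)"
proof -
  have "rec_nat 1 (\<lambda>n r. r + r) b = (2 :: nat) ^ b" for b by (induction b) auto
  moreover have "computable (\<lambda>v. rec_nat 1 (\<lambda>n r. r + r) (F v))"
    by (intro computable_rec computable_const computable_var computable_add assms)
  ultimately show ?thesis by simp
qed

lemma computable_prod_encode:
  assumes "computable F" "computable G" shows "computable (\<lambda>v. prod_encode (F v, G v))"
proof -
  have "rec_nat 0 (\<lambda>n r. r + Suc n) b = triangle b" for b by (induction b) auto
  moreover have "computable (\<lambda>v. rec_nat 0 (\<lambda>n r. r + Suc n) (F v + G v) + F v)"
    by (intro computable_rec computable_const computable_var computable_add computable_Suc assms)
  ultimately show ?thesis by (simp add: prod_encode_def)
qed

lemma computable_shift: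
  assumes "computable F" shows "computable (\<lambda>v. F (\<lambda>i. v (Suc i)))"
  by (rule computable_subst[OF assms computable_var])

text \<open>Bit \<open>x\<close> of \<open>n\<close> in a form to which the closure rules apply:
  \<open>q + q + 1\<close> is the odd quotient of \<open>n\<close> by the power of two and
  \<open>r\<close> is the remainder.\<close>

lemma mem_set_decode_iff:
  "x \<in> set_decode n \<longleftrightarrow> (\<exists>q<Suc n. \<exists>r<2 ^ x. n = (q + q + 1) * 2 ^ x + r)" (is "_ \<longleftrightarrow> ?R")
proof -
  have "odd (n div 2 ^ x)" if "n = (q + q + 1) * 2 ^ x + r" "r < 2 ^ x" for q r :: nat
  proof -
    have "n div 2 ^ x = q + q + 1" unfolding that(1) using that(2) by (subst div_mult_self3) simp_all
    then show ?thesis by simp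
  qed
  then have "?R \<Longrightarrow> odd (n div 2 ^ x)" by blast
  moreover have ?R if odd: "odd (n div 2 ^ x)"
  proof -
    obtain q where "n div 2 ^ x = 2 * q + 1" using odd by (rule oddE)
    then have q: "n div 2 ^ x = q + q + 1" by simp
    have "n = (n div 2 ^ x) * 2 ^ x + n mod 2 ^ x" by (rule div_mult_mod_eq[symmetric])
    then have "n = (q + q + 1) * 2 ^ x + n mod 2 ^ x" unfolding q .
    moreover have "q < Suc n" using q div_le_dividend[of n "2 ^ x"] by linarith
    moreover have "n mod 2 ^ x < 2 ^ x" by simp
    ultimately show ?thesis by blast
  qed
  ultimately show ?thesis unfolding set_decode_def mem_Collect_eq by blast
qed

lemma decid_set_decode:
  assumes "computable F" "computable G" shows "decid (\<lambda>v. F v \<in> set_decode (G v))"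
proof -
  note s = computable_shift[OF assms(1)] computable_shift[OF assms(2)]
  note s2 = computable_shift[OF s(1)] computable_shift[OF s(2)]
  show ?thesis unfolding mem_set_decode_iff
    by (intro decid_ex decid_eq computable_add computable_mult computable_var computable_const
        computable_power2 computable_Suc s s2 assms)
qed

text \<open>Decoding is done by search: one component is found by minimisation, and the other is at
  most the code of the pair.\<close>

lemma computable_fst_decode:
  assumes "computable F" shows "computable (\<lambda>v. fst (prod_decode (F v)))"
proof -
  note s = computable_shift[OF assms] computable_shift[OF computable_shift[OF assms]]
  have ex: "\<exists>b<Suc n. n = prod_encode (fst (prod_decode n), b)" for n
    by (rule exI[of _ "snd (prod_decode n)"])
       (metis le_imp_less_Suc le_prod_encode_2 prod.collapse prod_decode_inverse)
  have "(LEAST a. \<exists>b<Suc n. n = prod_encode (a, b)) = fst (prod_decode n)" for n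
    by (rule Least_equality) (use ex in auto)
  moreover have "computable (\<lambda>v. LEAST a. \<exists>b<Suc (F v). F v = prod_encode (a, b))"
    by (intro computable_Least decid_ex decid_eq computable_prod_encode computable_Suc computable_var s)
       (use ex in blast)
  ultimately show ?thesis by simp
qed

lemma computable_snd_decode:
  assumes "computable F" shows "computable (\<lambda>v. snd (prod_decode (F v)))"
proof -
  note s = computable_shift[OF assms] computable_shift[OF computable_shift[OF assms]]
  have ex: "\<exists>a<Suc n. n = prod_encode (a, snd (prod_decode n))" for n
    by (rule exI[of _ "fst (prod_decode n)"])
       (metis le_imp_less_Suc le_prod_encode_1 prod.collapse prod_decode_inverse)
  have "(LEAST b. \<exists>a<Suc n. n = prod_encode (a, b)) = snd (prod_decode n)" for n
    by (rule Least_equality) (use ex in auto)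
  moreover have "computable (\<lambda>v. LEAST b. \<exists>a<Suc (F v). F v = prod_encode (a, b))"
    by (intro computable_Least decid_ex decid_eq computable_prod_encode computable_Suc computable_var s)
       (use ex in blast)
  ultimately show ?thesis by simp
qed

text \<open>The code of a nonempty list is the successor of the pair of its head and the code of its
  tail. So \<open>i\<close> rounds of the recursion drop \<open>i\<close> entries, and
  \<open>x\<close> is a member iff it heads one of the tails obtained.\<close>

lemma set_list_decode_iff:
  "x \<in> set (list_decode l) \<longleftrightarrow> (\<exists>i<l. \<exists>y<l. 
     rec_nat l (\<lambda>_ r. snd (prod_decode (r - 1))) i = Suc (prod_encode (x, y)))"
proof -
  define d where "d i l = rec_nat l (\<lambda>_ r. snd (prod_decode (r - 1))) i" for i l
  have d0: "d 0 l = l" for l by (simp add: d_def)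
  have dS: "d (Suc i) (Suc (prod_encode (a, l))) = d i l" for i a l
    by (induction i) (simp_all add: d_def)
  have dz: "d i 0 = 0" for i
  proof (induction i)
    case (Suc i) 
    \<comment> \<open>The code 0 of the empty list is a fixed point of the recursion, so running
      past the end yields no spurious member.\<close>
    have "prod_decode 0 = (0, 0)" by (simp add: prod_decode_def prod_decode_aux.simps)
    then show ?case using Suc by (simp add: d_def)
  qed (simp add: d_def)
  have "x \<in> set xs \<longleftrightarrow> (\<exists>i<list_encode xs. \<exists>y<list_encode xs. d i (list_encode xs) = Suc (prod_encode (x, y)))" for xs
  proof (induction xs)
    case (Cons a xs)
    define l where "l = list_encode xs"
    have le: "list_encode (a # xs) = Suc (prod_encode (a, l))" by (simp add: l_def)
    have lb: "l \<le> prod_encode (a, l)" by (rule le_prod_encode_2)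
    show ?case unfolding le
    proof safe
      assume "x \<in> set (a # xs)"
      then consider "x = a" | "x \<in> set xs" by auto
      then show "\<exists>i<Suc (prod_encode (a, l)). \<exists>y<Suc (prod_encode (a, l)). d i (Suc (prod_encode (a, l))) = Suc (prod_encode (x, y))"
      proof cases
        case 1
        then show ?thesis using lb by (intro exI[of _ 0] conjI exI[of _ l]) (auto simp: d0)
      next
        case 2
        then obtain i y where "i < l" "y < l" "d i l = Suc (prod_encode (x, y))"
          using Cons.IH by (auto simp: l_def)
        then show ?thesis using lb by (intro exI[of _ "Suc i"] conjI exI[of _ y]) (auto simp: dS)
      qed
    next
      fix i y assume *: "i < Suc (prod_encode (a, l))" "d i (Suc (prod_encode (a, l))) = Suc (prod_encode (x, y))"
      show "x \<in> set (a # xs)"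
      proof (cases i)
        case 0
        then show ?thesis using * by (simp add: d0 prod_encode_eq)
      next
        case (Suc j)
        \<comment> \<open>Passing to a tail lowers the code, so both bounds that occur in the
          induction hypothesis hold automatically.\<close>
        have bnd: "d j l = Suc (prod_encode (x, y)) \<Longrightarrow> j < l \<and> y < l" for j y l
        proof (induction j arbitrary: l)
          case 0
          then show ?case using le_prod_encode_2[of y x] by (simp add: d0)
        next
          case (Suc j)
          show ?case
          proof (cases l)
            case 0
            then show ?thesis using Suc.prems by (simp add: dz)
          next
            case (Suc m)
            obtain b k where m: "m = prod_encode (b, k)" by (metis prod_decode_inverse surj_pair)
            have "d j k = Suc (prod_encode (x, y))" using Suc.prems by (simp add: Suc m dS)
            then show ?thesis using Suc.IH[of k] le_prod_encode_2[of k b] Suc m by auto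
          qed
        qed
        have "d j l = Suc (prod_encode (x, y))" using * Suc by (simp add: dS)
        moreover from bnd[OF this] have "j < l" "y < l" by auto
        ultimately have "x \<in> set xs" using Cons.IH unfolding l_def by blast
        then show ?thesis by simp
      qed
    qed
  qed simp
  from this[of "list_decode l"] show ?thesis unfolding d_def list_decode_inverse .
qed

lemma decid_set_list_decode:
  assumes "computable F" "computable G" shows "decid (\<lambda>v. F v \<in> set (list_decode (G v)))"
proof -
  note s1 = computable_shift[OF assms(1)] computable_shift[OF assms(2)]
  note s2 = computable_shift[OF s1(1)] computable_shift[OF s1(2)]
  show ?thesis unfolding set_list_decode_iff
    by (intro decid_ex decid_eq computable_rec computable_snd_decode computable_pred computable_prod_encode
       computable_var computable_Suc s1 s2 assms)
qed

text \<open>The decision problem has two inputs, whereas \<open>F\<close> may read more variables: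
  variable 0 receives the first input and all the others the second.\<close>

lemma recursive_2_of_computable:
  assumes "computable F"
  shows "\<exists>f. recursive 2 f \<and> (\<forall>a b. f [a, b] = F (case_nat a (\<lambda>_. b)))"
proof -
  obtain k f where f: "recursive k f" "\<And>v. F v = f (map v [0..<k])"
    using assms by (auto simp: computable_def)
  define gs :: "(nat list \<Rightarrow> nat) list" where "gs = map (\<lambda>i xs. xs ! min i 1) [0..<k]"
  have "recursive 2 (\<lambda>xs. f (map (\<lambda>g. g xs) gs))"
    using f(1) by (intro recursive.comp) (auto simp: gs_def intro!: recursive.proj)
  moreover have "map (\<lambda>g. g [a, b]) gs = map (case_nat a (\<lambda>_. b)) [0..<k]" for a b :: nat
    by (auto simp: gs_def split: nat.split)
  ultimately show ?thesis using f(2) by auto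
qed

section \<open>Special monoids\<close>

locale special_presentation =
  fixes A :: "'a set" and W :: "'a list set"
  assumes finite_A: "finite A" and finite_W: "finite W" and W_lists: "W \<subseteq> lists A"
begin

section \<open>Congruence of words and invertible words\<close>

abbreviation cong (infix "\<sim>" 50) where "u \<sim> v \<equiv> (u, v) \<in> pres_cong A (special_rels W)"

definition invertible where "invertible w \<longleftrightarrow> (\<exists>v. w @ v \<sim> [] \<and> v @ w \<sim> [])"

lemma cong_lists: "u \<sim> v \<Longrightarrow> u \<in> lists A" "u \<sim> v \<Longrightarrow> v \<in> lists A"
  using pres_cong_lists by blast+

lemma cong_append: 
  assumes "u \<sim> v" "u' \<sim> v'" shows "u @ u' \<sim> v @ v'"
proof -
  have "u @ u' \<sim> v @ u'" 
    using pres_cong_append[OF assms(1), of "[]" u'] cong_lists[OF assms(2)] by simp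
  moreover have "v @ u' \<sim> v @ v'" 
    using pres_cong_append[OF assms(2), of v "[]"] cong_lists[OF assms(1)] by simp
  ultimately show ?thesis by (rule pres_cong.trans)
qed

lemma W_cong: "w \<in> W \<Longrightarrow> w \<sim> []"
  using pres_cong.rel[of w "[]" "special_rels W" A "[]" "[]"] W_lists by (auto simp: special_rels_def)

lemma cong_insert:
  assumes "w \<in> W" "x \<in> lists A" "y \<in> lists A" shows "x @ w @ y \<sim> x @ y"
  using pres_cong_append[OF W_cong[OF assms(1)] assms(2,3)] by simp

lemma invertible_lists: "invertible w \<Longrightarrow> w \<in> lists A"
  unfolding invertible_def by (auto dest!: cong_lists(1))

lemma invertible_Nil: "invertible []"
  unfolding invertible_def by (auto intro!: exI[of _ "[]"] pres_cong.refl)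

lemma invertible_cong: 
  assumes "u \<sim> v" "invertible u" shows "invertible v"
proof -
  obtain z where z: "u @ z \<sim> []" "z @ u \<sim> []" using assms(2) by (auto simp: invertible_def)
  have "z \<sim> z" using cong_lists(1)[OF z(1)] by (auto intro: pres_cong.refl)
  then have "v @ z \<sim> []" "z @ v \<sim> []"
    using z cong_append[OF assms(1)] cong_append[OF _ assms(1)]
    by (meson pres_cong.sym pres_cong.trans)+
  then show ?thesis unfolding invertible_def by blast
qed

lemma cong_mid:
  assumes "x @ y \<sim> z" "u \<sim> []" shows "x @ u @ y \<sim> z"
proof -
  have "x \<in> lists A" "y \<in> lists A" using cong_lists(1)[OF assms(1)] by auto
  then have "x @ u @ y \<sim> x @ y" using pres_cong_append[OF assms(2), of x y] by simp
  then show ?thesis using assms(1) by (blast intro: pres_cong.trans)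
qed

lemma invertible_append: 
  assumes "invertible x" "invertible y" shows "invertible (x @ y)"
proof -
  obtain x' y' where *: "x @ x' \<sim> []" "x' @ x \<sim> []" "y @ y' \<sim> []" "y' @ y \<sim> []"
    using assms by (auto simp: invertible_def)
  have "x @ (y @ y') @ x' \<sim> []" "y' @ (x' @ x) @ y \<sim> []" 
    by (rule cong_mid; rule *)+
  then show ?thesis unfolding invertible_def by (intro exI[of _ "y' @ x'"]) simp
qed

text \<open>A left and a right inverse agree, since both are equal to
  \<open>l @ w @ r\<close>.\<close>

lemma invertibleI: 
  assumes "w @ r \<sim> []" "l @ w \<sim> []" shows "invertible w"
proof -
  have "l @ (w @ r) \<sim> l" using assms cong_lists(1)[OF assms(2)] 
    using cong_append[OF pres_cong.refl assms(1), of l] by auto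
  moreover have "(l @ w) @ r \<sim> r" using assms cong_lists(1)[OF assms(1)] 
    using cong_append[OF assms(2) pres_cong.refl, of r] by auto
  ultimately have "l \<sim> r" by (auto intro: pres_cong.sym pres_cong.trans)
  moreover have "w \<sim> w" using cong_lists(1)[OF assms(1)] by (auto intro: pres_cong.refl)
  ultimately have "l @ w \<sim> r @ w" by (rule cong_append)
  then have "r @ w \<sim> []" using assms(2) by (blast intro: pres_cong.sym pres_cong.trans)
  then show ?thesis using assms(1) unfolding invertible_def by blast
qed

text \<open>The overlap argument: as a suffix of an invertible word \<open>w\<close> is left
  invertible, and as a prefix of a word equal to 1 it is right invertible. It is applied to a
  relator in which an invertible prefix ends.\<close>

lemma invertible_middle:
  assumes "invertible (x @ w)" "w @ y \<sim> []" shows "invertible w"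
proof -
  obtain z where "z @ x @ w \<sim> []" using assms(1) by (auto simp: invertible_def)
  then show ?thesis using invertibleI[OF assms(2), of "z @ x"] by simp
qed

lemma invertible_appendD1:
  assumes "invertible (x @ y)" "invertible x" shows "invertible y"
proof -
  obtain x' where x': "x @ x' \<sim> []" "x' @ x \<sim> []" using assms(2) by (auto simp: invertible_def)
  have "invertible x'" using x' by (auto simp: invertible_def)
  have "invertible (x' @ x @ y)" by (rule invertible_append; fact)
  moreover have "x' @ x @ y \<sim> y"
    using cong_append[OF x'(2) pres_cong.refl, of y] invertible_lists[OF assms(1)] by simp
  ultimately show ?thesis using invertible_cong by blast
qed

lemma invertible_appendD2:
  assumes "invertible (x @ y)" "invertible y" shows "invertible x"
proof -
  obtain y' where y': "y @ y' \<sim> []" "y' @ y \<sim> []" using assms(2) by (auto simp: invertible_def)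
  have "invertible y'" using y' by (auto simp: invertible_def)
  have "invertible ((x @ y) @ y')" by (rule invertible_append; fact)
  moreover have "x @ (y @ y') \<sim> x"
    using cong_append[OF pres_cong.refl y'(1), of x] invertible_lists[OF assms(1)] by simp
  ultimately show ?thesis using invertible_cong by auto
qed

section \<open>Equality of words, level by level\<close>

definition noprefix where "noprefix p \<longleftrightarrow> (\<forall>k l. p = k @ l \<longrightarrow> invertible k \<longrightarrow> k = [])"

text \<open>The \<open>noprefix\<close> premises make \<open>h\<close> and \<open>h'\<close> the
  longest invertible prefixes. This pins down the decomposition of each word, on which transitivity
  rests.\<close>

inductive levelwise where
  levelwise_unit: "invertible u \<Longrightarrow> u \<sim> v \<Longrightarrow> levelwise u v"
| levelwise_step: "invertible h \<Longrightarrow> h \<sim> h' \<Longrightarrow> a \<in> A \<Longrightarrow> noprefix (a # r) \<Longrightarrow> noprefix (a # r') \<Longrightarrow> levelwise r r'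
    \<Longrightarrow> levelwise (h @ a # r) (h' @ a # r')"

lemma longest_inv_prefix: 
  obtains h p where "u = h @ p" "invertible h" "noprefix p"
proof -
  have "\<exists>h p. u = h @ p \<and> invertible h \<and> noprefix p"
  proof (induction "length u" arbitrary: u rule: less_induct)
    case less
    show ?case
    proof (cases "noprefix u")
      case True
      then show ?thesis using invertible_Nil by (intro exI[of _ "[]"] exI[of _ u]) auto
    next
      case False
      then obtain k l where k: "u = k @ l" "invertible k" "k \<noteq> []" by (auto simp: noprefix_def)
      then have "length l < length u" by simp
      then obtain h p where "l = h @ p" "invertible h" "noprefix p" using less by blast
      then show ?thesis using k invertible_append by (intro exI[of _ "k @ h"] exI[of _ p]) auto
    qed
  qed
  then show thesis using that by blast
qed

text \<open>One of the two prefixes extends the other by some \<open>k\<close>. By cancellation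
  \<open>k\<close> is invertible, and it is a prefix of one of the remainders, hence empty.\<close>

lemma invertible_prefix_unique:
  assumes "h @ p = h' @ p'" "invertible h" "invertible h'" "noprefix p" "noprefix p'"
  shows "h = h' \<and> p = p'"
proof -
  obtain k where "h = h' @ k \<and> k @ p = p' \<or> h @ k = h' \<and> p = k @ p'"
    using assms(1) by (auto simp: append_eq_append_conv2)
  then show ?thesis
  proof
    assume k: "h = h' @ k \<and> k @ p = p'"
    then have "invertible k" using assms invertible_appendD1 by blast
    then have "k = []" using assms(5) k unfolding noprefix_def by blast
    then show ?thesis using k by simp
  next
    assume k: "h @ k = h' \<and> p = k @ p'"
    then have "invertible k" using assms invertible_appendD1 by blast
    then have "k = []" using assms(4) k unfolding noprefix_def by blast
    then show ?thesis using k by simp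
  qed
qed

lemma noprefix_not_inv: "noprefix (a # r) \<Longrightarrow> \<not> invertible (a # r)"
  unfolding noprefix_def by (metis append_Nil2 list.discI)

lemma noprefix_not_inv': "noprefix (a # r) \<Longrightarrow> invertible h \<Longrightarrow> \<not> invertible (h @ a # r)"
  using invertible_appendD1 noprefix_not_inv by blast

lemma levelwise_refl: "u \<in> lists A \<Longrightarrow> levelwise u u"
proof (induction "length u" arbitrary: u rule: less_induct)
  case less
  obtain h p where u: "u = h @ p" "invertible h" "noprefix p" by (rule longest_inv_prefix)
  show ?case
  proof (cases p)
    case Nil
    then show ?thesis using u less.prems by (auto intro: levelwise_unit pres_cong.refl)
  next
    case (Cons a r)
    have "levelwise r r" using less u Cons by auto
    then show ?thesis using u less.prems Cons by (auto intro: levelwise_step pres_cong.refl)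
  qed
qed

lemma levelwise_sym: "levelwise u v \<Longrightarrow> levelwise v u"
proof (induction rule: levelwise.induct)
  case (levelwise_unit u v)
  then show ?case by (blast intro: levelwise.levelwise_unit pres_cong.sym invertible_cong)
next
  case (levelwise_step h h' a r r')
  then show ?case by (blast intro: levelwise.levelwise_step pres_cong.sym invertible_cong)
qed

text \<open>The middle word is decomposed in only one way, so both derivations end with the same
  rule at the same position.\<close>

lemma levelwise_trans: "levelwise u v \<Longrightarrow> levelwise v z \<Longrightarrow> levelwise u z"
proof (induction arbitrary: z rule: levelwise.induct)
  case (levelwise_unit u v)
  from levelwise_unit(3) show ?case
  proof cases
    case levelwise_unit
    then show ?thesis using levelwise_unit.hyps by (blast intro: levelwise.levelwise_unit pres_cong.trans)
  next
    case (levelwise_step h h' a r r')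
    then show ?thesis using levelwise_unit.hyps noprefix_not_inv' invertible_cong by blast
  qed
next
  case (levelwise_step h h' a r r')
  have "invertible h'" using levelwise_step invertible_cong by blast
  from levelwise_step.prems show ?case
  proof cases
    case levelwise_unit
    then show ?thesis using levelwise_step.hyps noprefix_not_inv'[OF _ \<open>invertible h'\<close>] by blast
  next
    case (levelwise_step k k' b s s')
    have "h' = k \<and> a # r' = b # s"
      using invertible_prefix_unique[OF levelwise_step(1) \<open>invertible h'\<close>] levelwise_step levelwise_step.hyps by blast
    then show ?thesis using levelwise_step levelwise_step.hyps levelwise_step.IH by (auto intro!: levelwise.levelwise_step intro: pres_cong.trans)
  qed
qed

lemma levelwise_same_suffix:
  assumes "invertible h" "h \<sim> h'" "noprefix p" "p \<in> lists A"
  shows "levelwise (h @ p) (h' @ p)"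
  using assms by (cases p) (auto intro: levelwise_unit levelwise_step levelwise_refl)

text \<open>If some prefix of \<open>y\<close> completes \<open>x\<close> to an invertible word, the
  relator disappears inside an invertible prefix, whose class is unchanged. Otherwise the longest
  invertible prefix of \<open>x\<close> is a proper one and is also the longest invertible prefix of
  both words; the induction hypothesis applies behind the letter that follows it.\<close>

lemma levelwise_delete:
  assumes "w \<in> W"
  shows "x \<in> lists A \<Longrightarrow> y \<in> lists A \<Longrightarrow> levelwise (x @ w @ y) (x @ y)"
proof (induction "length x" arbitrary: x rule: less_induct)
  case less
  note w = W_cong[OF assms]
  show ?case
  proof (cases "\<exists>y1 q. y = y1 @ q \<and> invertible (x @ y1)")
    case True
    then obtain y1 q where q: "y = y1 @ q" "invertible (x @ y1)" by blast
    \<comment> \<open>The invertible prefix is extended as far as possible, which leaves both words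
      with the same remainder \<open>q'\<close>.\<close>
    obtain h1 q' where q': "q = h1 @ q'" "invertible h1" "noprefix q'" by (rule longest_inv_prefix)
    let ?k = "y1 @ h1"
    have invertible: "invertible (x @ ?k)" using invertible_append[OF q(2) q'(2)] by simp
    have "x @ w @ ?k \<sim> x @ ?k" using cong_insert[OF assms, of x ?k] invertible_lists[OF invertible] by auto
    moreover then have "invertible (x @ w @ ?k)" using invertible invertible_cong pres_cong.sym by blast
    ultimately have "levelwise ((x @ w @ ?k) @ q') ((x @ ?k) @ q')"
      using q'(3) less.prems q(1) q'(1) by (intro levelwise_same_suffix) auto
    then show ?thesis using q q' by simp
  next
    case False
    then have F: "\<And>y1 q. y = y1 @ q \<Longrightarrow> \<not> invertible (x @ y1)" by blast
    obtain h p where x: "x = h @ p" "invertible h" "noprefix p" by (rule longest_inv_prefix)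
    have F': "\<not> invertible (p @ y1)" if "y = y1 @ q" for y1 q
      using F[OF that] invertible_append[OF x(2), of "p @ y1"] x(1) by auto
    have np1: "noprefix (p @ y)"
      unfolding noprefix_def
    proof (intro allI impI)
      fix k l assume k: "p @ y = k @ l" "invertible k"
      then obtain m where "p = k @ m \<or> (k = p @ m \<and> y = m @ l)"
        by (auto simp: append_eq_append_conv2)
      then show "k = []" using F' k x(3) unfolding noprefix_def by blast
    qed
    \<comment> \<open>An invertible prefix \<open>k\<close> can end in \<open>p\<close>, in the
      relator or behind it. If it ends in the relator, the overlap with the relator is invertible,
      hence so is \<open>p\<close>. If it ends behind, the relator can be removed from
      \<open>k\<close>. Both contradict the case assumption.\<close>
    have np2: "noprefix (p @ w @ y)"
      unfolding noprefix_def
    proof (intro allI impI)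
      fix k l assume k: "p @ w @ y = k @ l" "invertible k"
      then consider m where "p = k @ m" | m m' where "k = p @ m" "w = m @ m'" | m where "k = p @ w @ m" "y = m @ l"
        by (fastforce simp: append_eq_append_conv2)
      then show "k = []"
      proof cases
        case 1
        then show ?thesis using k x(3) unfolding noprefix_def by blast
      next
        case 2
        then have "invertible m" using invertible_middle[of p m m'] k w by simp
        then have "invertible p" using 2 k invertible_appendD2 by blast
        then show ?thesis using F'[of "[]" y] by simp
      next
        case 3
        have "p @ w @ m \<sim> p @ m" using 3 less.prems x cong_insert[OF assms] by auto
        then have "invertible (p @ m)" using 3 k invertible_cong by blast
        then show ?thesis using F' 3 by blast
      qed
    qed
    have "p \<noteq> []" using F'[of "[]" y] invertible_Nil by auto
    then obtain a x' where p: "p = a # x'" by (cases p) auto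
    have "levelwise (x' @ w @ y) (x' @ y)" using less x p by auto
    then have "levelwise (h @ a # (x' @ w @ y)) (h @ a # (x' @ y))"
      using np1 np2 p x less.prems by (intro levelwise_step) (auto intro: pres_cong.refl)
    then show ?thesis using x p by simp
  qed
qed

lemma cong_imp_levelwise: "u \<sim> v \<Longrightarrow> levelwise u v"
proof (induction rule: pres_cong.induct)
  case (rel u v x y)
  then show ?case using levelwise_delete by (auto simp: special_rels_def)
next
  case (refl w)
  then show ?case by (rule levelwise_refl)
next
  case (sym u v)
  from sym.IH show ?case by (rule levelwise_sym)
next
  case (trans u v w)
  then show ?case using levelwise_trans by blast
qed

section \<open>Factors of relators and the primes among the invertible words\<close>

text \<open>Letters and the empty word need not be factors of relators; with them the set is still
  closed under factors.\<close>

definition Omega where "Omega = {z. \<exists>x y. x @ z @ y \<in> W} \<union> {[a] | a. a \<in> A} \<union> {[]}"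

lemma Omega_factor: 
  assumes "x @ y \<in> Omega" shows "x \<in> Omega" "y \<in> Omega"
proof -
  from assms consider u v where "u @ (x @ y) @ v \<in> W" | a where "x @ y = [a]" "a \<in> A" | "x @ y = []"
    unfolding Omega_def by blast
  then have "x \<in> Omega \<and> y \<in> Omega"
  proof cases
    case 1
    then have "u @ x @ (y @ v) \<in> W" "(u @ x) @ y @ v \<in> W" by simp_all
    then show ?thesis unfolding Omega_def by blast
  qed (auto simp: Omega_def append_eq_Cons_conv)
  then show "x \<in> Omega" "y \<in> Omega" by auto
qed

lemma Omega_lists: "Omega \<subseteq> lists A"
  using W_lists unfolding Omega_def by fastforce

lemma finite_Omega: "finite Omega"
proof -
  have "{z. \<exists>x y. x @ z @ y \<in> W} \<subseteq> (\<Union>w\<in>W. (\<lambda>(i, j). take i (drop j w)) ` ({..length w} \<times> {..length w}))"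
  proof clarify
    fix z x y assume w: "x @ z @ y \<in> W"
    have "z = take (length z) (drop (length x) (x @ z @ y))" by simp
    then show "z \<in> (\<Union>w\<in>W. (\<lambda>(i, j). take i (drop j w)) ` ({..length w} \<times> {..length w}))"
      using w by (intro UN_I[of "x @ z @ y"] image_eqI[of _ _ "(length z, length x)"]) auto
  qed
  moreover have "finite \<dots>" using finite_W by blast
  ultimately have "finite {z. \<exists>x y. x @ z @ y \<in> W}" by (rule finite_subset)
  then show ?thesis unfolding Omega_def using finite_A by auto
qed

text \<open>The primes freely generate the submonoid of invertible words, by
  \<open>prime_decomp\<close> and \<open>prime_unique\<close>.\<close>

definition prime where 
  "prime p \<longleftrightarrow> invertible p \<and> p \<noteq> [] \<and> (\<forall>k l. p = k @ l \<longrightarrow> invertible k \<longrightarrow> k = [] \<or> l = [])"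

text \<open>The first letter is fixed and only the rest is taken up to congruence. This is what
  survives the insertion of a relator strictly inside a prime, because such an insertion comes after
  the first letter.\<close>

definition good where "good p \<longleftrightarrow> (\<exists>a z z'. p = a # z \<and> z \<sim> z' \<and> a # z' \<in> Omega)"

inductive Good where
  Good_Nil: "Good []"
| Good_append: "prime p \<Longrightarrow> good p \<Longrightarrow> Good u \<Longrightarrow> Good (p @ u)"

lemma prime_decomp:
  assumes "invertible u" "u \<noteq> []" obtains p v where "u = p @ v" "prime p" "invertible v"
proof -
  have "\<exists>p v. u = p @ v \<and> prime p \<and> invertible v"
    using assms
  proof (induction "length u" arbitrary: u rule: less_induct)
    case less
    show ?case
    proof (cases "prime u")
      case True
      then show ?thesis using invertible_Nil by (intro exI[of _ u] exI[of _ "[]"]) auto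
    next
      case False
      then obtain k l where k: "u = k @ l" "invertible k" "k \<noteq> []" "l \<noteq> []" 
        using less.prems by (auto simp: prime_def)
      then obtain p v where p: "k = p @ v" "prime p" "invertible v" using less(1)[of k] by auto
      then have "invertible (v @ l)" using k less.prems invertible_appendD1[of p "v @ l"] by (auto simp: prime_def)
      then show ?thesis using k p by (intro exI[of _ p] exI[of _ "v @ l"]) auto
    qed
  qed
  then show thesis using that by blast
qed

lemma prime_unique:
  assumes "p @ u = q @ v" "prime p" "prime q" shows "p = q \<and> u = v"
proof -
  obtain k where "p = q @ k \<and> k @ u = v \<or> p @ k = q \<and> u = k @ v"
    using assms(1) by (auto simp: append_eq_append_conv2)
  then show ?thesis using assms unfolding prime_def by (metis append_Nil append_Nil2)
qed

lemma Good_appendD: 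
  assumes "Good (p @ u)" "prime p" shows "good p \<and> Good u"
  using assms(1)
proof cases
  case Good_Nil
  then show ?thesis using assms(2) by (simp add: prime_def)
next
  case (Good_append q v)
  then show ?thesis using prime_unique[OF Good_append(1) assms(2)] by auto
qed

lemma Good_prime_append: "prime p \<Longrightarrow> Good (p @ u) \<longleftrightarrow> good p \<and> Good u"
  using Good_appendD Good_append by blast

text \<open>By unique factorisation the primes of \<open>u\<close> are the first primes of
  \<open>u @ v\<close>; they are split off one at a time.\<close>

lemma Good_append_iff: "invertible u \<Longrightarrow> Good (u @ v) \<longleftrightarrow> Good u \<and> Good v"
proof (induction "length u" arbitrary: u rule: less_induct)
  case less
  show ?case
  proof (cases "u = []")
    case True
    then show ?thesis by (simp add: Good_Nil)
  next
    case False
    then obtain p u' where u: "u = p @ u'" "prime p" "invertible u'" using prime_decomp less.prems by metis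
    then have "length u' < length u" by (auto simp: prime_def)
    then show ?thesis using u less(1)[of u'] by (auto simp: Good_prime_append)
  qed
qed

lemma Good_factor: "invertible u \<Longrightarrow> u \<in> Omega \<Longrightarrow> Good u"
proof (induction "length u" arbitrary: u rule: less_induct)
  case less
  show ?case
  proof (cases "u = []")
    case True
    then show ?thesis by (simp add: Good_Nil)
  next
    case False
    then obtain p u' where u: "u = p @ u'" "prime p" "invertible u'" using prime_decomp less.prems by metis
    then have "length u' < length u" by (auto simp: prime_def)
    moreover have O: "p \<in> Omega" "u' \<in> Omega" using less.prems u Omega_factor by blast+
    ultimately have "Good u'" using less(1) u by blast
    moreover have "good p"
    proof -
      obtain a z where p: "p = a # z" using u(2) by (cases p) (auto simp: prime_def)
      then have "z \<sim> z" using O(1) Omega_lists by (intro pres_cong.refl) auto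
      then show ?thesis using p O(1) unfolding good_def by blast
    qed
    ultimately show ?thesis using u Good_append by blast
  qed
qed

text \<open>Primes that lie inside \<open>x\<close> are split off by induction. If nothing of
  \<open>x\<close> remains, the relator is a factor of \<open>u @ v\<close> by itself and a product
  of good primes. Otherwise one prime contains the place of the deletion in its interior, and it
  stays prime, with the same first letter and a congruent rest.\<close>

lemma Good_delete:
  assumes "w \<in> W"
  shows "invertible (x @ y) \<Longrightarrow> Good (x @ w @ y) \<longleftrightarrow> Good (x @ y)"
proof (induction "length x" arbitrary: x rule: less_induct)
  case less
  note w = W_cong[OF assms]
  then have invertible_w: "invertible w" using invertible_Nil invertible_cong pres_cong.sym by blast
  have "[] @ w @ [] \<in> W" using assms by simp
  then have "w \<in> Omega" unfolding Omega_def by blast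
  then have Gw: "Good w" using Good_factor invertible_w by blast
  have xy: "x \<in> lists A" "y \<in> lists A" using invertible_lists[OF less.prems] by auto
  show ?case
  proof (cases "invertible x")
    case True
    then show ?thesis using invertible_w Gw by (simp add: Good_append_iff)
  next
    case False
    then have "x \<noteq> []" using invertible_Nil by auto
    then obtain p u where u: "x @ y = p @ u" "prime p" "invertible u" using prime_decomp[OF less.prems] by auto
    then obtain k where "x = p @ k \<and> k @ y = u \<or> x @ k = p \<and> y = k @ u"
      by (auto simp: append_eq_append_conv2)
    then show ?thesis
    proof
      assume k: "x = p @ k \<and> k @ y = u"
      then have "length k < length x" using u by (auto simp: prime_def)
      then show ?thesis using k u less(1)[of k] by (simp add: Good_prime_append)
    next
      assume k: "x @ k = p \<and> y = k @ u"
      obtain a z where x: "x = a # z" using \<open>x \<noteq> []\<close> by (cases x) auto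
      have c: "z @ w @ k \<sim> z @ k" using cong_insert[OF assms] xy k x by auto
      have "x @ w @ k \<sim> p" using cong_insert[OF assms] xy k by auto
      then have "invertible (x @ w @ k)" using u(2) unfolding prime_def using invertible_cong pres_cong.sym by blast
      \<comment> \<open>A proper invertible prefix that ends in the relator would make the overlap
        invertible, and with it \<open>x\<close>. One that ends elsewhere gives, after removal of
        the relator, an invertible prefix of the prime \<open>p\<close>.\<close>
      have "prime (x @ w @ k)"
        unfolding prime_def
      proof (intro conjI allI impI)
        fix s t assume s: "x @ w @ k = s @ t" "invertible s"
        then consider m where "x = s @ m" | m m' where "s = x @ m" "w = m @ m'" 
          | m where "s = x @ w @ m" "k = m @ t"
          by (fastforce simp: append_eq_append_conv2)
        then show "s = [] \<or> t = []"
        proof cases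
          case 1
          then have "p = s @ (m @ k)" using k by simp
          then have "s = [] \<or> m @ k = []" using u(2) s(2) unfolding prime_def by blast
          then show ?thesis using 1 False s by auto
        next
          case 2
          then have "invertible m" using invertible_middle[of x m m'] s w by simp
          then show ?thesis using 2 s False invertible_appendD2 by blast
        next
          case 3
          have "x @ w @ m \<sim> x @ m" using 3 k xy cong_insert[OF assms] by auto
          then have "invertible (x @ m)" using 3 s invertible_cong by blast
          moreover have "p = (x @ m) @ t" using 3 k by simp
          ultimately have "x @ m = [] \<or> t = []" using u(2) unfolding prime_def by blast
          then show ?thesis using \<open>x \<noteq> []\<close> by auto
        qed
      qed (use \<open>x \<noteq> []\<close> \<open>invertible (x @ w @ k)\<close> in auto)
      moreover have "good (x @ w @ k) \<longleftrightarrow> good p"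
      proof -
        have "p = a # (z @ k)" "x @ w @ k = a # (z @ w @ k)" using k x by auto
        then show ?thesis unfolding good_def using c by (auto intro: pres_cong.trans pres_cong.sym)
      qed
      ultimately have "Good ((x @ w @ k) @ u) \<longleftrightarrow> Good (p @ u)"
        using u by (simp only: Good_prime_append)
      moreover have "x @ w @ y = (x @ w @ k) @ u" using k by simp
      ultimately have "Good (x @ w @ y) \<longleftrightarrow> Good (p @ u)" by (simp only:)
      then show ?thesis unfolding u(1) .
    qed
  qed
qed

lemma Good_cong: "u \<sim> v \<Longrightarrow> invertible u \<Longrightarrow> Good u \<longleftrightarrow> Good v"
proof (induction rule: pres_cong.induct)
  case (rel u v x y)
  then have u: "u \<in> W" "v = []" by (auto simp: special_rels_def)
  have "x @ u @ y \<sim> x @ y" using u rel cong_insert by blast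
  then have "invertible (x @ y)" using rel invertible_cong by blast
  then show ?case using u Good_delete by simp
next
  case (sym u v)
  then show ?case using invertible_cong pres_cong.sym by blast
next
  case (trans u v w)
  then show ?case using invertible_cong by blast
qed simp

text \<open>Multiply the prime by an inverse \<open>v\<close>. The product is congruent to the empty
  word, which is trivially \<open>Good\<close>; since \<open>Good\<close> respects congruence of
  invertible words, the first prime of \<open>p @ v\<close> is good.\<close>

lemma prime_good:
  assumes "prime p" shows "good p"
proof -
  have p: "invertible p" using assms by (simp add: prime_def)
  then obtain v where v: "p @ v \<sim> []" by (auto simp: invertible_def)
  then have "invertible (p @ v)" using invertible_Nil invertible_cong pres_cong.sym by blast
  then have "Good (p @ v)" using Good_cong[OF v] Good_Nil by blast
  then show ?thesis using assms Good_appendD by blast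
qed

end

section \<open>Virtually free groups\<close>

definition flip :: "'x \<times> bool \<Rightarrow> 'x \<times> bool" where "flip a = (fst a, \<not> snd a)"

text \<open>The head of the list is the top of the stack, so \<open>stack w\<close> is the reversed
  freely reduced form of \<open>w\<close>.\<close>

definition push :: "'x \<times> bool \<Rightarrow> ('x \<times> bool) list \<Rightarrow> ('x \<times> bool) list" where
  "push a s = (if s \<noteq> [] \<and> hd s = flip a then tl s else a # s)"

abbreviation stack :: "('x \<times> bool) list \<Rightarrow> ('x \<times> bool) list" where
  "stack w \<equiv> fold push w []"

definition reduced :: "('x \<times> bool) list \<Rightarrow> bool" where
  "reduced s \<longleftrightarrow> successively (\<lambda>a b. b \<noteq> flip a) s"

lemma flip_flip [simp]: "flip (flip a) = a"
  by (simp add: flip_def)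

lemma reduced_push: "reduced s \<Longrightarrow> reduced (push a s)"
  by (cases s) (auto simp: push_def reduced_def successively_Cons)

lemma push_flip_push: "reduced s \<Longrightarrow> push (flip a) (push a s) = s"
  by (cases s) (auto simp: push_def reduced_def successively_Cons neq_Nil_conv)

lemma reduced_fold_push: "reduced s \<Longrightarrow> reduced (fold push w s)"
  by (induction w arbitrary: s) (auto intro: reduced_push)

lemma length_push: "length (push a s) \<le> Suc (length s)"
  by (auto simp: push_def)

lemma length_fold_push: "length (fold push w s) \<le> length w + length s"
proof (induction w arbitrary: s)
  case (Cons a w)
  have "length (fold push w (push a s)) \<le> length w + length (push a s)" by (rule Cons.IH)
  then show ?case using length_push[of a s] by simp
qed simp

lemma set_push: "set (push a s) \<subseteq> insert a (set s)"
  by (cases s) (auto simp: push_def)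

lemma set_fold_push: "set (fold push w s) \<subseteq> set w \<union> set s"
proof (induction w arbitrary: s)
  case (Cons a w)
  have "set (fold push w (push a s)) \<subseteq> set w \<union> set (push a s)" by (rule Cons.IH)
  then show ?case using set_push[of a s] by auto
qed simp

abbreviation free_rels :: "'x set \<Rightarrow> (('x \<times> bool) list \<times> ('x \<times> bool) list) set" where
  "free_rels X \<equiv> special_rels {[(x, b), (x, \<not> b)] |x b. x \<in> X}"

text \<open>Van der Waerden's argument: on reduced stacks \<open>push a\<close> and
  \<open>push (flip a)\<close> are mutually inverse, so the action of words on reduced stacks
  factors through the free group.\<close>

lemma fold_push_cong:
  "(u, v) \<in> pres_cong (X \<times> UNIV) (free_rels X) \<Longrightarrow> reduced s \<Longrightarrow> fold push u s = fold push v s"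
proof (induction arbitrary: s rule: pres_cong.induct)
  case (rel u v x y)
  then obtain a where u: "u = [a, flip a]" "v = []" by (auto simp: special_rels_def flip_def)
  have "reduced (fold push x s)" using rel reduced_fold_push by blast
  then show ?case using u by (simp add: push_flip_push)
qed auto

lemma stack_cong: "(u, v) \<in> pres_cong (X \<times> UNIV) (free_rels X) \<Longrightarrow> stack u = stack v"
  by (rule fold_push_cong) (auto simp: reduced_def)

text \<open>Changes happen only at the top, so the bottom part \<open>m\<close> was the whole stack
  at some moment. In the Cayley tree: a path visits every vertex on the geodesic to its end.\<close>

lemma stack_prefix:
  "stack w = s @ m \<Longrightarrow> \<exists>p q. w = p @ q \<and> stack p = m"
proof (induction w arbitrary: s rule: rev_induct)
  case (snoc a w)
  show ?case
  proof (cases s)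
    case Nil
    then show ?thesis using snoc.prems by (intro exI[of _ "w @ [a]"] exI[of _ "[]"]) simp
  next
    case (Cons b s')
    have "push a (stack w) = s @ m" using snoc.prems by simp
    then have "\<exists>s''. stack w = s'' @ m"
      using Cons by (auto simp: push_def split: if_splits) (metis append_Cons list.collapse)
    then obtain p q where "w = p @ q" "stack p = m" using snoc.IH by blast
    then show ?thesis by (intro exI[of _ p] exI[of _ "q @ [a]"]) simp
  qed
qed simp

text \<open>Locates the step of a path in which a given prefix of the spelled word ends.\<close>

lemma concat_eq_append:
  assumes "concat ks = p @ q" "ks \<noteq> []"
  obtains ks1 k k' ks2 where "ks = ks1 @ (k @ k') # ks2" "p = concat ks1 @ k" "q = k' @ concat ks2"
proof -
  have "\<exists>ks1 k k' ks2. ks = ks1 @ (k @ k') # ks2 \<and> p = concat ks1 @ k \<and> q = k' @ concat ks2"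
    using assms
  proof (induction ks arbitrary: p)
    case (Cons x ks)
    then obtain m where "x = p @ m \<and> m @ concat ks = q \<or> x @ m = p \<and> concat ks = m @ q"
      by (auto simp: append_eq_append_conv2)
    then show ?case
    proof
      assume "x = p @ m \<and> m @ concat ks = q"
      then show ?thesis by (intro exI[of _ "[]"] exI[of _ p] exI[of _ m] exI[of _ ks]) auto
    next
      assume m: "x @ m = p \<and> concat ks = m @ q"
      show ?thesis
      proof (cases "ks = []")
        case True
        then show ?thesis using m by (intro exI[of _ "[]"] exI[of _ x] exI[of _ "[]"] exI[of _ "[]"]) auto
      next
        case False
        then obtain ks1 k k' ks2 where "ks = ks1 @ (k @ k') # ks2" "m = concat ks1 @ k" "q = k' @ concat ks2"
          using Cons.IH[of m] m by blast
        then show ?thesis using m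
          by (intro exI[of _ "x # ks1"] exI[of _ k] exI[of _ k'] exI[of _ ks2]) auto
      qed
    qed
  qed simp
  then show thesis using that by blast
qed

text \<open>\<open>\<phi>\<close> maps words onto a free subgroup \<open>H\<close>, and \<open>rep\<close> picks a representative of each right coset of
  \<open>H\<close>.\<close>

locale free_extension = group G for G (structure) +
  fixes L :: "('x \<times> bool) set" and \<phi> :: "('x \<times> bool) list \<Rightarrow> 'a" and rep :: "'a \<Rightarrow> 'a"
  assumes phi_closed: "u \<in> lists L \<Longrightarrow> \<phi> u \<in> carrier G"
    and phi_append: "u \<in> lists L \<Longrightarrow> v \<in> lists L \<Longrightarrow> \<phi> (u @ v) = \<phi> u \<otimes> \<phi> v"
    and phi_Nil: "\<phi> [] = \<one>"
    and phi_flip: "a \<in> L \<Longrightarrow> \<phi> [a, flip a] = \<one>"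
    and phi_stack: "u \<in> lists L \<Longrightarrow> v \<in> lists L \<Longrightarrow> \<phi> u = \<phi> v \<Longrightarrow> stack u = stack v"
    and flip_L: "a \<in> L \<Longrightarrow> flip a \<in> L"
    and rep_closed: "g \<in> carrier G \<Longrightarrow> rep g \<in> carrier G"
    and rep_decomp: "g \<in> carrier G \<Longrightarrow> \<exists>u\<in>lists L. g = \<phi> u \<otimes> rep g"
    and rep_unique: "u \<in> lists L \<Longrightarrow> v \<in> lists L \<Longrightarrow> g \<in> carrier G \<Longrightarrow> g' \<in> carrier G
        \<Longrightarrow> \<phi> u \<otimes> rep g = \<phi> v \<otimes> rep g' \<Longrightarrow> rep g = rep g'"
    and finite_rep: "finite (rep ` carrier G)"
begin

text \<open>Free reduction preserves the value, because whatever is popped cancels with the letter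
  being read.\<close>

lemma phi_rev_stack: "u \<in> lists L \<Longrightarrow> \<phi> (rev (stack u)) = \<phi> u"
proof (induction u rule: rev_induct)
  case (snoc a u)
  then have u: "u \<in> lists L" "a \<in> L" by auto
  have s: "stack u \<in> lists L" using set_fold_push[of u "[]"] u by auto
  have "\<phi> (rev (push a s)) = \<phi> (rev s) \<otimes> \<phi> [a]" if s: "s \<in> lists L" for s
  proof (cases "s \<noteq> [] \<and> hd s = flip a")
    case True
    then obtain t where t: "s = flip a # t" by (cases s) auto
    then have tL: "rev t \<in> lists L" "flip a \<in> L" "rev t @ [flip a] \<in> lists L" using s by auto
    have "\<phi> (rev s) \<otimes> \<phi> [a] = \<phi> (rev t @ [flip a, flip (flip a)])"
      using t tL u phi_append[OF tL(3), of "[a]"] by simp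
    also have "\<dots> = \<phi> (rev t) \<otimes> \<phi> [flip a, flip (flip a)]"
      using tL u by (intro phi_append) auto
    also have "\<dots> = \<phi> (rev t)" using tL phi_flip[OF tL(2)] phi_closed[OF tL(1)] by simp
    finally show ?thesis using t by (simp add: push_def)
  next
    case False
    have "\<phi> (rev s @ [a]) = \<phi> (rev s) \<otimes> \<phi> [a]" using s u by (intro phi_append) auto
    then show ?thesis using False by (auto simp: push_def)
  qed
  from this[OF s] show ?case using snoc.IH u phi_append[of u "[a]"] by simp
qed simp

definition winv :: "('x \<times> bool) list \<Rightarrow> ('x \<times> bool) list" where "winv u = rev (map flip u)"

lemma length_winv: "length (winv u) = length u"
  by (simp add: winv_def)

lemma winv_lists: "u \<in> lists L \<Longrightarrow> winv u \<in> lists L"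
  by (auto simp: winv_def flip_L)

lemma phi_winv_right: "u \<in> lists L \<Longrightarrow> \<phi> u \<otimes> \<phi> (winv u) = \<one>"
proof (induction u rule: rev_induct)
  case Nil
  then show ?case by (simp add: winv_def phi_Nil)
next
  case (snoc a u)
  then have u: "u \<in> lists L" "a \<in> L" "winv u \<in> lists L" "flip a \<in> L" 
    using winv_lists flip_L by auto
  have "\<phi> (u @ [a]) \<otimes> \<phi> (winv (u @ [a])) = \<phi> ((u @ [a]) @ winv (u @ [a]))"
    using u by (intro phi_append[symmetric]) (auto simp: winv_def)
  also have "\<dots> = \<phi> (u @ [a, flip a] @ winv u)" by (simp add: winv_def)
  also have "\<dots> = \<phi> u \<otimes> (\<phi> [a, flip a] \<otimes> \<phi> (winv u))"
    using u by (subst phi_append[of u], force, force, subst phi_append[of "[a, flip a]"]) auto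
  also have "\<dots> = \<one>" using snoc u phi_flip[OF u(2)] phi_closed[OF u(3)] by simp
  finally show ?case .
qed

lemma phi_winv: "u \<in> lists L \<Longrightarrow> \<phi> (winv u) = inv (\<phi> u)"
  using phi_winv_right[of u] phi_closed winv_lists by (metis inv_equality inv_inv)

lemma rep_rep: 
  assumes "g \<in> carrier G" shows "rep (rep g) = rep g"
proof -
  obtain u where "u \<in> lists L" "rep g = \<phi> u \<otimes> rep (rep g)" 
    using rep_decomp[OF rep_closed[OF assms]] by blast
  then show ?thesis using rep_unique[of "[]" u g "rep g"] phi_Nil rep_closed[OF assms] assms by auto
qed

section \<open>Rewriting of products along coset representatives\<close>

abbreviation prodl :: "'a list \<Rightarrow> 'a" where "prodl ss \<equiv> foldr (\<otimes>) ss \<one>"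

lemma prodl_closed: "set ss \<subseteq> carrier G \<Longrightarrow> prodl ss \<in> carrier G"
  by (induction ss) auto

text \<open>Schreier rewriting: the part in \<open>H\<close> that is split off when the
  representative \<open>t\<close> is multiplied by \<open>s\<close>. The choice depends on the pair
  only, so finitely many factors produce finitely many step words.\<close>

definition step_word :: "'a \<Rightarrow> 'a \<Rightarrow> ('x \<times> bool) list" where
  "step_word t s = (SOME u. u \<in> lists L \<and> t \<otimes> s = \<phi> u \<otimes> rep (t \<otimes> s))"

lemma step_word: 
  assumes "t \<in> carrier G" "s \<in> carrier G"
  shows "step_word t s \<in> lists L" "t \<otimes> s = \<phi> (step_word t s) \<otimes> rep (t \<otimes> s)"
  using someI_ex[of "\<lambda>u. u \<in> lists L \<and> t \<otimes> s = \<phi> u \<otimes> rep (t \<otimes> s)"] rep_decomp[of "t \<otimes> s"] assms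
  unfolding step_word_def by auto

fun step_words :: "'a \<Rightarrow> 'a list \<Rightarrow> ('x \<times> bool) list list" where
  "step_words t [] = []"
| "step_words t (s # ss) = step_word t s # step_words (rep (t \<otimes> s)) ss"

fun endpoint :: "'a \<Rightarrow> 'a list \<Rightarrow> 'a" where
  "endpoint t [] = t"
| "endpoint t (s # ss) = endpoint (rep (t \<otimes> s)) ss"

lemma step_words_append: "step_words t (ss @ ts) = step_words t ss @ step_words (endpoint t ss) ts"
  by (induction ss arbitrary: t) auto

lemma length_step_words: "length (step_words t ss) = length ss"
  by (induction ss arbitrary: t) auto

lemma endpoint_closed: "t \<in> rep ` carrier G \<Longrightarrow> set ss \<subseteq> carrier G \<Longrightarrow> endpoint t ss \<in> rep ` carrier G"
  by (induction ss arbitrary: t) (auto simp: rep_closed)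

lemma step_words_lists:
  "t \<in> rep ` carrier G \<Longrightarrow> set ss \<subseteq> S \<Longrightarrow> S \<subseteq> carrier G \<Longrightarrow> 
   set (step_words t ss) \<subseteq> (\<lambda>(t, s). step_word t s) ` (rep ` carrier G \<times> S)"
proof (induction ss arbitrary: t)
  case (Cons s ss)
  then have ts: "t \<in> carrier G" "s \<in> S" "s \<in> carrier G" "set ss \<subseteq> S" using rep_closed by auto
  then have "rep (t \<otimes> s) \<in> rep ` carrier G" by (intro imageI m_closed)
  then have "set (step_words (rep (t \<otimes> s)) ss) \<subseteq> (\<lambda>(t, s). step_word t s) ` (rep ` carrier G \<times> S)"
    by (rule Cons.IH) fact+
  moreover have "step_word t s \<in> (\<lambda>(t, s). step_word t s) ` (rep ` carrier G \<times> S)"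
    by (rule image_eqI[of _ _ "(t, s)"]) (use Cons.prems(1) ts(2) in simp_all)
  ultimately show ?case by simp
qed simp

lemma step_words_L: "t \<in> rep ` carrier G \<Longrightarrow> set ss \<subseteq> carrier G \<Longrightarrow> set (step_words t ss) \<subseteq> lists L"
proof -
  assume "t \<in> rep ` carrier G" "set ss \<subseteq> carrier G"
  then have "set (step_words t ss) \<subseteq> (\<lambda>(t, s). step_word t s) ` (rep ` carrier G \<times> carrier G)"
    by (rule step_words_lists) simp
  moreover have "(\<lambda>(t, s). step_word t s) ` (rep ` carrier G \<times> carrier G) \<subseteq> lists L"
  proof (rule image_subsetI)
    fix p assume "p \<in> rep ` carrier G \<times> carrier G"
    then obtain g s where p: "p = (rep g, s)" "g \<in> carrier G" "s \<in> carrier G" by blast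
    show "(case p of (t, s) \<Rightarrow> step_word t s) \<in> lists L" 
      unfolding p(1) prod.case by (rule step_word(1)[OF rep_closed[OF p(2)] p(3)])
  qed
  ultimately show ?thesis by (rule subset_trans)
qed

lemma concat_step_words_L: "t \<in> rep ` carrier G \<Longrightarrow> set ss \<subseteq> carrier G \<Longrightarrow> concat (step_words t ss) \<in> lists L"
proof -
  assume "t \<in> rep ` carrier G" "set ss \<subseteq> carrier G"
  then have "set (step_words t ss) \<subseteq> lists L" by (rule step_words_L)
  then show ?thesis unfolding lists_eq_set mem_Collect_eq set_concat by blast
qed

text \<open>Telescoping: each factor is traded for its step word and the next
  representative.\<close>

lemma step_words_prodl:
  "t \<in> rep ` carrier G \<Longrightarrow> set ss \<subseteq> carrier G \<Longrightarrow> t \<otimes> prodl ss = \<phi> (concat (step_words t ss)) \<otimes> endpoint t ss"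
proof (induction ss arbitrary: t)
  case Nil
  then show ?case by (auto simp: phi_Nil rep_closed)
next
  case (Cons s ss)
  then have c: "t \<in> carrier G" "s \<in> carrier G" "prodl ss \<in> carrier G" "set ss \<subseteq> carrier G" 
    using rep_closed prodl_closed by auto
  let ?t = "rep (t \<otimes> s)"
  have t: "?t \<in> rep ` carrier G" "?t \<in> carrier G" using c rep_closed by auto
  have e: "endpoint ?t ss \<in> carrier G" using endpoint_closed[OF t(1) c(4)] rep_closed by auto
  note L = step_word(1)[OF c(1,2)] concat_step_words_L[OF t(1) c(4)]
  have "t \<otimes> prodl (s # ss) = (t \<otimes> s) \<otimes> prodl ss" using c by (simp add: m_assoc)
  also have "\<dots> = (\<phi> (step_word t s) \<otimes> ?t) \<otimes> prodl ss" using step_word(2)[OF c(1,2)] by simp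
  also have "\<dots> = \<phi> (step_word t s) \<otimes> (?t \<otimes> prodl ss)" using c t phi_closed[OF L(1)] by (simp add: m_assoc)
  also have "\<dots> = \<phi> (step_word t s) \<otimes> (\<phi> (concat (step_words ?t ss)) \<otimes> endpoint ?t ss)"
    using Cons.IH[OF t(1) c(4)] by simp
  also have "\<dots> = \<phi> (step_word t s @ concat (step_words ?t ss)) \<otimes> endpoint ?t ss"
    using phi_append[OF L] phi_closed[OF L(1)] phi_closed[OF L(2)] e by (simp add: m_assoc)
  finally show ?case by simp
qed

section \<open>Balls in the group and the cutting of products\<close>

text \<open>Elements of bounded length in the free subgroup, up to representatives on both sides.
  The factor \<open>inv x\<close> allows the rewriting to start at any coset, as it must for the
  right part of a cut product.\<close>

definition product_ball :: "('x \<times> bool) set \<Rightarrow> nat \<Rightarrow> 'a set" where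
  "product_ball Y n = {inv x \<otimes> \<phi> u \<otimes> y | x u y. x \<in> rep ` carrier G \<and> y \<in> rep ` carrier G 
      \<and> u \<in> lists Y \<and> length u \<le> n}"

lemma finite_product_ball: 
  assumes "finite Y" shows "finite (product_ball Y n)"
proof -
  have "product_ball Y n \<subseteq> (\<lambda>(x, u, y). inv x \<otimes> \<phi> u \<otimes> y) ` 
      (rep ` carrier G \<times> {u. set u \<subseteq> Y \<and> length u \<le> n} \<times> rep ` carrier G)"
  proof
    fix b assume "b \<in> product_ball Y n"
    then obtain x u y where b: "b = inv x \<otimes> \<phi> u \<otimes> y" "x \<in> rep ` carrier G" "y \<in> rep ` carrier G"
      "u \<in> lists Y" "length u \<le> n" unfolding product_ball_def by blast
    then have "set u \<subseteq> Y" unfolding lists_eq_set by blast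
    then show "b \<in> (\<lambda>(x, u, y). inv x \<otimes> \<phi> u \<otimes> y) ` 
      (rep ` carrier G \<times> {u. set u \<subseteq> Y \<and> length u \<le> n} \<times> rep ` carrier G)"
      using b by (intro image_eqI[of _ _ "(x, u, y)"]) simp_all
  qed
  then show ?thesis
    by (rule finite_subset) (intro finite_imageI finite_cartesian_product finite_rep finite_lists_length_le assms)
qed

lemma prodl_in_product_ball:
  assumes "t \<in> rep ` carrier G" "set ss \<subseteq> carrier G" "u \<in> lists Y" "Y \<subseteq> L" "length u \<le> n"
    "\<phi> (concat (step_words t ss)) = \<phi> u"
  shows "prodl ss \<in> product_ball Y n"
proof -
  have e: "endpoint t ss \<in> rep ` carrier G" "endpoint t ss \<in> carrier G"
    using endpoint_closed[OF assms(1,2)] rep_closed by auto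
  have t: "t \<in> carrier G" using assms rep_closed by auto
  have u: "\<phi> u \<in> carrier G" using assms by (intro phi_closed) auto
  have "t \<otimes> prodl ss = \<phi> u \<otimes> endpoint t ss" using step_words_prodl[OF assms(1,2)] assms(6) by simp
  moreover have "prodl ss = inv t \<otimes> (t \<otimes> prodl ss)"
    using t prodl_closed[OF assms(2)] by (simp add: m_assoc[symmetric])
  ultimately have "prodl ss = inv t \<otimes> (\<phi> u \<otimes> endpoint t ss)" by simp
  then have "prodl ss = inv t \<otimes> \<phi> u \<otimes> endpoint t ss" using t u e by (simp add: m_assoc)
  then show ?thesis unfolding product_ball_def using assms(1,3,5) e(1) by blast
qed

text \<open>The path of the word through the free group passes through the stack \<open>m\<close> in the middle of the
  reduced form of its end; the word is cut at the step in which this happens, or just before this step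
  if it is the last one.\<close>

lemma product_ball_split:
  assumes Y: "Y \<subseteq> L" "\<And>a. a \<in> Y \<Longrightarrow> flip a \<in> Y" and S: "S \<subseteq> carrier G"
    and step_word_N: "\<And>t s. t \<in> rep ` carrier G \<Longrightarrow> s \<in> S \<Longrightarrow> step_word t s \<in> lists Y \<and> length (step_word t s) \<le> N"
    and ss: "set ss \<subseteq> S" "length ss \<ge> 2" "prodl ss \<in> product_ball Y (2 * N + 2)"
  shows "\<exists>xs ys. ss = xs @ ys \<and> xs \<noteq> [] \<and> ys \<noteq> [] \<and> 
     prodl xs \<in> product_ball Y (2 * N + 2) \<and> prodl ys \<in> product_ball Y (2 * N + 2)"
proof -
  obtain x u y where u: "prodl ss = inv x \<otimes> \<phi> u \<otimes> y" "x \<in> rep ` carrier G" "y \<in> rep ` carrier G"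
    "u \<in> lists Y" "length u \<le> 2 * N + 2" using ss(3) unfolding product_ball_def by blast
  have ssG: "set ss \<subseteq> carrier G" using ss S by auto
  have YL: "w \<in> lists Y \<Longrightarrow> w \<in> lists L" for w using Y by auto
  have xy: "x \<in> carrier G" "y \<in> carrier G" "rep y = y" using u rep_closed rep_rep by auto
  have uc: "u \<in> lists L" "\<phi> u \<in> carrier G" using u YL phi_closed by auto
  let ?ks = "step_words x ss"
  have ksY: "set ?ks \<subseteq> {k \<in> lists Y. length k \<le> N}"
  proof
    fix k assume "k \<in> set ?ks"
    then have "k \<in> (\<lambda>(t, s). step_word t s) ` (rep ` carrier G \<times> S)"
      using step_words_lists[OF u(2) ss(1) S] by (rule rev_subsetD)
    then obtain ts where "k = (case ts of (t, s) \<Rightarrow> step_word t s)" "ts \<in> rep ` carrier G \<times> S" by (rule imageE)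
    then obtain t s where k: "k = step_word t s" "t \<in> rep ` carrier G" "s \<in> S" by (cases ts) simp
    show "k \<in> {k \<in> lists Y. length k \<le> N}" unfolding k(1) mem_Collect_eq by (rule step_word_N[OF k(2,3)])
  qed
  then have cY: "concat ?ks \<in> lists Y"
    unfolding lists_eq_set mem_Collect_eq set_concat by blast
  have "x \<otimes> prodl ss = \<phi> u \<otimes> y" using u(1) xy uc by (simp add: m_assoc[symmetric])
  then have e: "\<phi> (concat ?ks) \<otimes> endpoint x ss = \<phi> u \<otimes> y" using step_words_prodl[OF u(2) ssG] by simp
  obtain g where g: "g \<in> carrier G" "endpoint x ss = rep g" using endpoint_closed[OF u(2) ssG] by auto
  \<comment> \<open>Both sides of \<open>e\<close> lie in the same coset and \<open>y\<close> is
    itself a representative. Hence the step words and \<open>u\<close> have the same value in the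
    free subgroup.\<close>
  have "endpoint x ss = y"
    using rep_unique[OF YL[OF cY] uc(1) g(1) xy(2)] e g xy(3) by simp
  then have "\<phi> (concat ?ks) = \<phi> u" using e xy uc phi_closed[OF YL[OF cY]] by simp
  then have st: "stack (concat ?ks) = stack u" using phi_stack YL cY uc by blast
  define s where "s = stack u"
  \<comment> \<open>The bottom half of the stack, which is the reversed first half of the reduced
    word. Both halves have at most \<open>N + 1\<close> letters; together with a piece of one step
    word, of at most \<open>N\<close> letters, they stay within the radius
    \<open>2 * N + 2\<close>.\<close>
  define m where "m = drop (length s div 2) s"
  define r where "r = take (length s div 2) s"
  have s: "s \<in> lists Y" "length s \<le> 2 * N + 2"
    using set_fold_push[of u "[]"] length_fold_push[of u "[]"] u by (auto simp: s_def)
  have srm: "s = r @ m" by (simp add: r_def m_def)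
  have "r @ m \<in> lists Y" using s(1) unfolding srm .
  then have mr0: "m \<in> lists Y" "r \<in> lists Y" unfolding append_in_lists_conv by blast+
  have "length m \<le> N + 1" "length r \<le> N + 1"
    using s(2) unfolding m_def r_def length_drop length_take by linarith+
  note mr = mr0 this
  have rY: "rev m \<in> lists Y" "rev r \<in> lists Y" using mr0 unfolding in_lists_conv_set set_rev by blast+
  note rL = rY[THEN YL]
  note rc = rL[THEN phi_closed] 
  have "stack (concat ?ks) = r @ m" using st s_def srm by simp
  then obtain p q where pq: "concat ?ks = p @ q" "stack p = m" using stack_prefix by blast
  have pqL: "p \<in> lists L" "q \<in> lists L" using YL[OF cY] pq by auto
  have phip: "\<phi> p = \<phi> (rev m)" using phi_rev_stack[OF pqL(1)] pq by simp
  have phiq: "\<phi> q = \<phi> (rev r)"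
  proof -
    have "\<phi> p \<otimes> \<phi> q = \<phi> (concat ?ks)" using phi_append[OF pqL] pq by simp
    also have "\<dots> = \<phi> (rev s)" using phi_rev_stack[OF YL[OF cY]] st s_def by simp
    also have "\<dots> = \<phi> (rev m) \<otimes> \<phi> (rev r)" unfolding srm rev_append by (rule phi_append[OF rL])
    finally show ?thesis unfolding phip using rc phi_closed[OF pqL(2)] by simp
  qed
  have "?ks \<noteq> []" using ss(2) length_step_words[of x ss] by auto
  then obtain ks1 k k' ks2 where ks: "?ks = ks1 @ (k @ k') # ks2" "p = concat ks1 @ k" "q = k' @ concat ks2"
    using concat_eq_append[OF pq(1)] by blast
  have kY: "k \<in> lists Y" "k' \<in> lists Y" "length k + length k' \<le> N" "concat ks1 \<in> lists Y" "concat ks2 \<in> lists Y"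
    using ksY unfolding ks(1) lists_eq_set by auto
  have winvY: "winv w \<in> lists Y" if "w \<in> lists Y" for w using that Y(2) by (auto simp: winv_def)
  note kL = YL[OF kY(1)] YL[OF kY(2)] YL[OF kY(4)] YL[OF kY(5)]
  note kc = kL[THEN phi_closed]
  have len: "length ss = length ks1 + Suc (length ks2)" using ks length_step_words[of x ss] by simp
  have key: ?thesis if "ss = xs @ ys" "xs \<noteq> []" "ys \<noteq> []" "v \<in> lists Y" "w \<in> lists Y" 
    "length v \<le> 2 * N + 2" "length w \<le> 2 * N + 2"
    "\<phi> (concat (step_words x xs)) = \<phi> v" "\<phi> (concat (step_words (endpoint x xs) ys)) = \<phi> w" for xs ys v w
  proof -
    have "set xs \<subseteq> carrier G" "set ys \<subseteq> carrier G" using ssG that(1) by auto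
    then have "prodl xs \<in> product_ball Y (2 * N + 2)" "prodl ys \<in> product_ball Y (2 * N + 2)" 
      using prodl_in_product_ball[OF u(2) _ that(4) Y(1) that(6,8)] 
        prodl_in_product_ball[OF endpoint_closed[OF u(2)] _ that(5) Y(1) that(7,9)] by blast+
    then show ?thesis using that by blast
  qed
  show ?thesis
  proof (cases "ks2 = []")
    case False
    define xs where "xs = take (Suc (length ks1)) ss"
    define ys where "ys = drop (Suc (length ks1)) ss"
    have "length xs = Suc (length ks1)" "ss = xs @ ys" using len by (auto simp: xs_def ys_def)
    then have "step_words x xs @ step_words (endpoint x xs) ys = (ks1 @ [k @ k']) @ ks2" "length (step_words x xs) = length (ks1 @ [k @ k'])"
      using ks(1) step_words_append[of x xs ys] length_step_words[of x xs] by simp_all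
    then have k1: "step_words x xs = ks1 @ [k @ k']" and k2: "step_words (endpoint x xs) ys = ks2"
      using append_eq_append_conv by blast+
    \<comment> \<open>The left part overshoots the middle by \<open>k'\<close>, and the right part
      has to begin by undoing \<open>k'\<close>.\<close>
    have e1: "\<phi> (concat (step_words x xs)) = \<phi> (rev m @ k')"
    proof -
      have "\<phi> (concat (step_words x xs)) = \<phi> (p @ k')" using k1 ks by simp
      also have "\<dots> = \<phi> (rev m) \<otimes> \<phi> k'" using phi_append[OF pqL(1) kL(2)] phip by simp
      also have "\<dots> = \<phi> (rev m @ k')" by (rule phi_append[OF rL(1) kL(2), symmetric])
      finally show ?thesis .
    qed
    have e2: "\<phi> (concat (step_words (endpoint x xs) ys)) = \<phi> (winv k' @ rev r)"
    proof -
      have "\<phi> (winv k' @ rev r) = inv (\<phi> k') \<otimes> \<phi> (rev r)"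
        using phi_append[OF winv_lists[OF kL(2)] rL(2)] phi_winv[OF kL(2)] by simp
      also have "\<phi> (rev r) = \<phi> k' \<otimes> \<phi> (concat ks2)" using phi_append[OF kL(2,4)] ks phiq by simp
      finally show ?thesis using kc k2 by (simp add: m_assoc[symmetric])
    qed
    show ?thesis
      by (rule key[OF \<open>ss = xs @ ys\<close> _ _ _ _ _ _ e1 e2])
        (use False len mr rY kY winvY length_winv in \<open>auto simp: xs_def ys_def\<close>)
  next
    case True
    define xs where "xs = take (length ks1) ss"
    define ys where "ys = drop (length ks1) ss"
    \<comment> \<open>There are at least two steps, so the last one is not the first and cutting
      before it leaves two nonempty parts. The left part now stops short of the middle by
      \<open>k\<close>.\<close>
    have ks1: "ks1 \<noteq> []" using True len ss(2) by auto
    have "length xs = length ks1" "ss = xs @ ys" using len by (auto simp: xs_def ys_def)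
    then have "step_words x xs @ step_words (endpoint x xs) ys = ks1 @ [k @ k']" "length (step_words x xs) = length ks1"
      using ks(1) step_words_append[of x xs ys] length_step_words[of x xs] True by simp_all
    then have k1: "step_words x xs = ks1" and k2: "step_words (endpoint x xs) ys = [k @ k']"
      using append_eq_append_conv by blast+
    have e1: "\<phi> (concat (step_words x xs)) = \<phi> (rev m @ winv k)"
    proof -
      have "\<phi> (rev m @ winv k) = \<phi> (rev m) \<otimes> inv (\<phi> k)"
        using phi_append[OF rL(1) winv_lists[OF kL(1)]] phi_winv[OF kL(1)] by simp
      also have "\<phi> (rev m) = \<phi> (concat ks1) \<otimes> \<phi> k" using phi_append[OF kL(3,1)] ks phip by simp
      finally show ?thesis using kc k1 by (simp add: m_assoc)
    qed
    have e2: "\<phi> (concat (step_words (endpoint x xs) ys)) = \<phi> (k @ k')" using k2 by simp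
    show ?thesis
      by (rule key[OF \<open>ss = xs @ ys\<close> _ _ _ _ _ _ e1 e2])
        (use ks1 len mr rY kY winvY length_winv in \<open>auto simp: xs_def ys_def\<close>)
  qed
qed

lemma product_ball_inv:
  assumes Y: "Y \<subseteq> L" "\<And>a. a \<in> Y \<Longrightarrow> flip a \<in> Y" and b: "b \<in> product_ball Y n"
  shows "inv b \<in> product_ball Y n"
proof -
  obtain x u y where b: "b = inv x \<otimes> \<phi> u \<otimes> y" "x \<in> rep ` carrier G" "y \<in> rep ` carrier G"
    "u \<in> lists Y" "length u \<le> n" using b unfolding product_ball_def by blast
  then have c: "x \<in> carrier G" "y \<in> carrier G" "u \<in> lists L" using rep_closed Y by auto
  have "inv b = inv y \<otimes> inv (\<phi> u) \<otimes> x" 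
    unfolding b(1) using c phi_closed[OF c(3)] by (simp add: inv_mult_group m_assoc)
  then have "inv b = inv y \<otimes> \<phi> (winv u) \<otimes> x" unfolding phi_winv[OF c(3)] .
  moreover have "winv u \<in> lists Y" "length (winv u) \<le> n"
    using b(4,5) Y(2) by (auto simp: winv_def)
  ultimately show ?thesis unfolding product_ball_def using b(2,3) by blast
qed

lemma finite_splitting_set:
  assumes S: "finite S" "S \<subseteq> carrier G"
  shows "\<exists>B. finite B \<and> S \<subseteq> B \<and> \<one> \<in> B \<and> B \<subseteq> carrier G \<and> (\<forall>b\<in>B. inv b \<in> B) \<and>
    (\<forall>ss. set ss \<subseteq> S \<longrightarrow> length ss \<ge> 2 \<longrightarrow> prodl ss \<in> B \<longrightarrow>
      (\<exists>xs ys. ss = xs @ ys \<and> xs \<noteq> [] \<and> ys \<noteq> [] \<and> prodl xs \<in> B \<and> prodl ys \<in> B))"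
proof -
  define K where "K = (\<lambda>(t, s). step_word t s) ` (rep ` carrier G \<times> S)"
  have K: "finite K" "K \<subseteq> lists L"
    using finite_rep S step_word(1) rep_closed unfolding K_def by fastforce+
  \<comment> \<open>Only finitely many letters occur in step words of elements of \<open>S\<close>,
    so balls over these letters are finite even when \<open>L\<close> is infinite.\<close>
  define Z where "Z = (\<Union>k\<in>K. set k)"
  define Y where "Y = Z \<union> flip ` Z"
  have Z: "finite Z" "Z \<subseteq> L" using K unfolding Z_def by auto
  have Y: "finite Y" "Y \<subseteq> L" "\<And>a. a \<in> Y \<Longrightarrow> flip a \<in> Y" using Z flip_L unfolding Y_def by auto
  \<comment> \<open>The 0 covers the case that there are no step words.\<close>
  define N where "N = Max (insert 0 (length ` K))"
  have N: "length k \<le> N" if "k \<in> K" for k using that K(1) unfolding N_def by simp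
  have step_word_N: "step_word t s \<in> lists Y \<and> length (step_word t s) \<le> N" if "t \<in> rep ` carrier G" "s \<in> S" for t s
  proof -
    have "step_word t s \<in> K" using that unfolding K_def by auto
    then show ?thesis using N unfolding Y_def Z_def by auto
  qed
  let ?B = "product_ball Y (2 * N + 2)"
  have t0: "rep \<one> \<in> rep ` carrier G" by simp
  have "s \<in> ?B" if s: "s \<in> S" for s
  proof -
    have "prodl [s] \<in> ?B"
      by (rule prodl_in_product_ball[OF t0 _ _ Y(2), of _ "step_word (rep \<one>) s"]) (use s S step_word_N[OF t0 s] in auto)
    then show ?thesis using s S by (simp add: subset_iff)
  qed
  moreover have "prodl [] \<in> ?B"
    by (rule prodl_in_product_ball[OF t0 _ _ Y(2), of _ "[]"]) auto
  moreover have "?B \<subseteq> carrier G"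
    unfolding product_ball_def using Y(2) by (auto intro!: m_closed inv_closed phi_closed rep_closed)
  ultimately show ?thesis
    using finite_product_ball[OF Y(1)] product_ball_split[OF Y(2,3) S(2) step_word_N] product_ball_inv[OF Y(2,3)] by (intro exI[of _ ?B]) auto
qed

end

section \<open>Virtually free groups as free extensions\<close>

lemma virtually_free_splitting_set:
  fixes G :: "('a, 'm) monoid_scheme" (structure)
  assumes "group G" "virtually_free G" and S: "finite S" "S \<subseteq> carrier G"
  shows "\<exists>B. finite B \<and> S \<subseteq> B \<and> \<one> \<in> B \<and> B \<subseteq> carrier G \<and> (\<forall>b\<in>B. inv b \<in> B) \<and>
    (\<forall>ss. set ss \<subseteq> S \<longrightarrow> length ss \<ge> 2 \<longrightarrow> foldr (\<otimes>) ss \<one> \<in> B \<longrightarrow>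
      (\<exists>xs ys. ss = xs @ ys \<and> xs \<noteq> [] \<and> ys \<noteq> [] \<and> foldr (\<otimes>) xs \<one> \<in> B \<and> foldr (\<otimes>) ys \<one> \<in> B))"
proof -
  interpret group G by fact
  obtain H where H: "subgroup H G" "finite (rcosets H)" and free: "is_free_group (G\<lparr>carrier := H\<rparr>)"
    using assms(2) unfolding virtually_free_def by (elim exE conjE) (rule that)
  from free obtain X :: "'a set" where "iso (free_group X) (G\<lparr>carrier := H\<rparr>) \<noteq> {}"
    unfolding is_free_group_def is_iso_def by (elim exE) (rule that)
  then obtain \<psi> where psi: "\<psi> \<in> iso (free_group X) (G\<lparr>carrier := H\<rparr>)" by auto
  let ?L = "X \<times> (UNIV :: bool set)"
  define \<phi> where "\<phi> u = \<psi> (canonical ?L (free_rels X) u)" for u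
  \<comment> \<open>A choice that depends on the coset alone: uniqueness of representatives is
    immediate, and finite index gives finitely many of them.\<close>
  define rep where "rep g = (SOME x. x \<in> H #> g)" for g
  have hom: "\<psi> \<in> hom (free_group X) (G\<lparr>carrier := H\<rparr>)" and bij: "bij_betw \<psi> (carrier (free_group X)) H"
    using psi by (auto simp: iso_def)
  have Hc: "H \<subseteq> carrier G" using H subgroup.subset by blast
  have can: "canonical ?L (free_rels X) u \<in> carrier (free_group X)" if "u \<in> lists ?L" for u
    using canonical_image[of ?L "free_rels X"] that unfolding free_group_def by blast
  have phiH: "\<phi> u \<in> H" if "u \<in> lists ?L" for u
    using can[OF that] bij by (auto simp: \<phi>_def bij_betw_def)
  have app: "\<phi> (u @ v) = \<phi> u \<otimes> \<phi> v" if "u \<in> lists ?L" "v \<in> lists ?L" for u v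
    using hom_mult[OF hom can[OF that(1)] can[OF that(2)]] canonical_append[OF that]
    by (simp add: \<phi>_def free_group_def)
  \<comment> \<open>An idempotent of a group is 1.\<close>
  have nil: "\<phi> [] = \<one>"
  proof -
    have "\<phi> [] \<otimes> \<phi> [] = \<phi> []" using app[of "[]" "[]"] by simp
    then show ?thesis using phiH[of "[]"] Hc by (metis l_cancel_one lists.Nil subsetD)
  qed
  have surj: "\<exists>u\<in>lists ?L. h = \<phi> u" if "h \<in> H" for h
  proof -
    obtain c where "c \<in> carrier (free_group X)" "h = \<psi> c" using bij \<open>h \<in> H\<close> by (auto simp: bij_betw_def)
    then have "c \<in> canonical ?L (free_rels X) ` lists ?L" "h = \<psi> c"
      using canonical_image[of ?L "free_rels X"] unfolding free_group_def by simp_all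
    then obtain u where "u \<in> lists ?L" "h = \<psi> (canonical ?L (free_rels X) u)" by (elim imageE) simp
    then show ?thesis unfolding \<phi>_def by (intro bexI[of _ u])
  qed
  have rep: "rep g \<in> H #> g" "H #> rep g = H #> g" if "g \<in> carrier G" for g
  proof -
    have "g \<in> H #> g" using rcos_self[OF that H(1)] .
    then show "rep g \<in> H #> g" unfolding rep_def by (rule someI)
    then show "H #> rep g = H #> g" using repr_independence[OF _ that H(1)] by simp
  qed
  have repc: "rep g \<in> carrier G" if "g \<in> carrier G" for g
    using rep(1)[OF that] r_coset_subset_G[OF Hc that] by blast
  interpret free_extension G ?L \<phi> rep
  proof
    show "\<phi> u \<in> carrier G" if "u \<in> lists ?L" for u using phiH[OF that] Hc by blast
    show "\<phi> (u @ v) = \<phi> u \<otimes> \<phi> v" if "u \<in> lists ?L" "v \<in> lists ?L" for u v using app that .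
    show "\<phi> [] = \<one>" by fact
    show "\<phi> [a, flip a] = \<one>" if "a \<in> ?L" for a
    proof -
      have fa: "flip a \<in> ?L" using that by (auto simp: flip_def)
      have "[a, flip a] \<in> {[(x, b), (x, \<not> b)] |x b. x \<in> X}" using that by (auto simp: flip_def)
      then have "([a, flip a], []) \<in> free_rels X" by (auto simp: special_rels_def)
      from pres_cong.rel[OF this, of ?L "[]" "[]"] have "([a, flip a], []) \<in> pres_cong ?L (free_rels X)"
        using that fa by auto
      then show ?thesis using nil unfolding \<phi>_def canonical_def 
        by (simp add: equiv_class_eq[OF equiv_pres_cong])
    qed
    show "stack u = stack v" if "u \<in> lists ?L" "v \<in> lists ?L" "\<phi> u = \<phi> v" for u v
    proof -
      have "canonical ?L (free_rels X) u = canonical ?L (free_rels X) v"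
        by (rule inj_onD[OF bij_betw_imp_inj_on[OF bij] that(3)[unfolded \<phi>_def] can[OF that(1)] can[OF that(2)]])
      then have "(u, v) \<in> pres_cong ?L (free_rels X)"
        unfolding canonical_def using eq_equiv_class[OF _ equiv_pres_cong that(2)] by blast
      then show ?thesis by (rule stack_cong)
    qed
    show "flip a \<in> ?L" if "a \<in> ?L" for a using that by (auto simp: flip_def)
    show "rep g \<in> carrier G" if "g \<in> carrier G" for g using repc that .
    show "\<exists>u\<in>lists ?L. g = \<phi> u \<otimes> rep g" if g: "g \<in> carrier G" for g
    proof -
      have "g \<in> H #> rep g" using rep(2)[OF g] rcos_self[OF g H(1)] by simp
      then obtain h where "h \<in> H" "g = h \<otimes> rep g" unfolding r_coset_def by blast
      then show ?thesis using surj by blast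
    qed
    show "rep g = rep g'" if "u \<in> lists ?L" "v \<in> lists ?L" "g \<in> carrier G" "g' \<in> carrier G"
      "\<phi> u \<otimes> rep g = \<phi> v \<otimes> rep g'" for u v g g'
    proof -
      have "H #> (\<phi> u \<otimes> rep g) = H #> g" if "u \<in> lists ?L" "g \<in> carrier G" for u g
      proof -
        have "H #> (\<phi> u \<otimes> rep g) = (H #> \<phi> u) #> rep g"
          using coset_mult_assoc[OF Hc, of "\<phi> u" "rep g"] phiH[OF that(1)] Hc repc[OF that(2)] by auto
        also have "H #> \<phi> u = H" using phiH[OF that(1)] Hc H(1) by (intro coset_join2) auto
        finally show ?thesis using rep(2)[OF that(2)] by simp
      qed
      from this[OF that(1,3)] this[OF that(2,4)] have "H #> g = H #> g'" using that(5) by simp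
      then show ?thesis unfolding rep_def by simp
    qed
    show "finite (rep ` carrier G)"
    proof -
      have "rep ` carrier G \<subseteq> (\<lambda>C. SOME x. x \<in> C) ` (rcosets H)"
        unfolding rep_def RCOSETS_def by auto
      then show ?thesis using H(2) finite_subset by blast
    qed
  qed
  show ?thesis using finite_splitting_set[OF S] by blast
qed

section \<open>A finite set of values closed under splitting\<close>

context special_presentation
begin

abbreviation "pm \<equiv> presented_monoid A (special_rels W)"
abbreviation "val \<equiv> canonical A (special_rels W)"
abbreviation mul (infixl "\<cdot>" 70) where "x \<cdot> y \<equiv> x \<otimes>\<^bsub>pm\<^esub> y"
abbreviation "idm \<equiv> \<one>\<^bsub>pm\<^esub>"

interpretation M: monoid pm by (rule monoid_presented_monoid)

interpretation U: group "units_of pm" by (rule M.units_group)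

lemma val_closed: "u \<in> lists A \<Longrightarrow> val u \<in> carrier pm"
  using canonical_image[of A "special_rels W"] by blast

lemma val_surj: "c \<in> carrier pm \<Longrightarrow> \<exists>u\<in>lists A. c = val u"
  using canonical_image[of A "special_rels W"] by blast

lemma val_eq_iff: "u \<in> lists A \<Longrightarrow> v \<in> lists A \<Longrightarrow> val u = val v \<longleftrightarrow> u \<sim> v"
  unfolding canonical_def by (rule eq_equiv_class_iff[OF equiv_pres_cong])

lemma val_Units: 
  assumes "u \<in> lists A" shows "val u \<in> Units pm \<longleftrightarrow> invertible u"
proof -
  have iff: "val z \<cdot> val u = idm \<longleftrightarrow> z @ u \<sim> []" "val u \<cdot> val z = idm \<longleftrightarrow> u @ z \<sim> []" 
    if "z \<in> lists A" for z
    using that assms val_eq_iff[of "z @ u" "[]"] val_eq_iff[of "u @ z" "[]"]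
    by (simp_all add: canonical_append canonical_Nil)
  show ?thesis
  proof
    assume "val u \<in> Units pm"
    then obtain y where y: "y \<in> carrier pm" "y \<cdot> val u = idm" "val u \<cdot> y = idm"
      unfolding Units_def by blast
    obtain z where z: "z \<in> lists A" "y = val z" using val_surj[OF y(1)] by blast
    have "z @ u \<sim> []" "u @ z \<sim> []" using y(2,3) iff[OF z(1)] unfolding z(2) by blast+
    then show "invertible u" unfolding invertible_def by blast
  next
    assume "invertible u"
    then obtain z where z: "z @ u \<sim> []" "u @ z \<sim> []" unfolding invertible_def by blast
    then have zl: "z \<in> lists A" using cong_lists(1) by fastforce
    have "val z \<cdot> val u = idm" "val u \<cdot> val z = idm" using z iff[OF zl] by blast+
    then show "val u \<in> Units pm" using val_closed[OF assms] val_closed[OF zl] unfolding Units_def by blast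
  qed
qed

lemma prime_list:
  assumes "invertible u" obtains ps where "u = concat ps" "\<forall>p\<in>set ps. prime p"
proof -
  have "\<exists>ps. u = concat ps \<and> (\<forall>p\<in>set ps. prime p)"
    using assms
  proof (induction "length u" arbitrary: u rule: less_induct)
    case less
    show ?case
    proof (cases "u = []")
      case True
      then show ?thesis by (intro exI[of _ "[]"]) simp
    next
      case False
      then obtain p v where p: "u = p @ v" "prime p" "invertible v" using prime_decomp less.prems by metis
      then have "length v < length u" by (auto simp: prime_def)
      then obtain ps where "v = concat ps" "\<forall>p\<in>set ps. prime p" using less(1) p(3) by blast
      then show ?thesis using p by (intro exI[of _ "p # ps"]) simp
    qed
  qed
  then show thesis using that by blast
qed

lemma prime_lists: "prime p \<Longrightarrow> p \<in> lists A"
  using invertible_lists unfolding prime_def by blast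

lemma concat_prime_lists: "\<forall>p\<in>set ps. prime p \<Longrightarrow> concat ps \<in> lists A"
proof (induction ps)
  case (Cons p ps)
  then show ?case using prime_lists[of p] by (simp only: concat.simps append_in_lists_conv list.set_intros) simp
qed simp

lemma prime_val_Units: "prime p \<Longrightarrow> val p \<in> Units pm"
  using val_Units[OF prime_lists] unfolding prime_def by blast

lemma concat_prime_invertible: "\<forall>p\<in>set ps. prime p \<Longrightarrow> invertible (concat ps)"
  by (induction ps) (auto intro: invertible_append invertible_Nil simp: prime_def)

abbreviation "uinv x \<equiv> m_inv (units_of pm) x"

lemma uinv: 
  assumes "x \<in> Units pm" 
  shows "uinv x \<in> Units pm" "uinv x \<cdot> x = idm" "x \<cdot> uinv x = idm"
  using U.inv_closed[of x] U.l_inv[of x] U.r_inv[of x] assms 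
  by (simp_all add: units_of_carrier units_of_mult units_of_one)

lemma foldr_val_primes:
  "\<forall>p\<in>set ps. prime p \<Longrightarrow> foldr (\<cdot>) (map val ps) idm = val (concat ps)"
proof (induction ps)
  case (Cons p ps)
  then have "p \<in> lists A" "concat ps \<in> lists A" using prime_lists concat_prime_lists by auto
  then show ?case using Cons by (simp add: canonical_append)
qed (simp add: canonical_Nil)

lemma Units_pm_closed: "x \<in> Units pm \<Longrightarrow> x \<in> carrier pm"
  unfolding Units_def by blast

lemma foldr_mul_closed: "set ss \<subseteq> carrier pm \<Longrightarrow> foldr (\<cdot>) ss idm \<in> carrier pm"
  by (induction ss) auto

lemma foldr_mul_Units: "set ss \<subseteq> Units pm \<Longrightarrow> foldr (\<cdot>) ss idm \<in> Units pm"
  by (induction ss) auto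

lemma foldr_mul_append: 
  "set ss \<subseteq> carrier pm \<Longrightarrow> set ts \<subseteq> carrier pm \<Longrightarrow> 
   foldr (\<cdot>) (ss @ ts) idm = foldr (\<cdot>) ss idm \<cdot> foldr (\<cdot>) ts idm"
  by (induction ss) (auto simp: M.m_assoc foldr_mul_closed)

text \<open>Lets a word on the right side of an equation be moved to the left as a product of
  inverses of its primes in reverse order.\<close>

lemma foldr_uinv_rev:
  "set ss \<subseteq> Units pm \<Longrightarrow> foldr (\<cdot>) (map uinv (rev ss)) idm = uinv (foldr (\<cdot>) ss idm)"
proof (induction ss)
  case Nil
  then show ?case using U.inv_one by (simp add: units_of_one)
next
  case (Cons s ss)
  then have s: "s \<in> Units pm" "set ss \<subseteq> Units pm" by auto
  have P: "foldr (\<cdot>) ss idm \<in> Units pm" using foldr_mul_Units[OF s(2)] .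
  have i: "set (map uinv (rev ss)) \<subseteq> carrier pm" using s(2) uinv(1) Units_pm_closed by auto
  have "foldr (\<cdot>) (map uinv (rev (s # ss))) idm = 
      foldr (\<cdot>) (map uinv (rev ss)) idm \<cdot> foldr (\<cdot>) [uinv s] idm"
    unfolding rev.simps map_append list.map
    by (rule foldr_mul_append[OF i]) (use uinv(1)[OF s(1)] Units_pm_closed in simp)
  also have "\<dots> = uinv (foldr (\<cdot>) ss idm) \<cdot> uinv s" 
    using Cons.IH[OF s(2)] Units_pm_closed[OF uinv(1)[OF s(1)]] by simp
  also have "\<dots> = uinv (s \<cdot> foldr (\<cdot>) ss idm)"
    using U.inv_mult_group[of s "foldr (\<cdot>) ss idm"] s P by (simp add: units_of_carrier units_of_mult)
  finally show ?case by simp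
qed

text \<open>Converse of \<open>cong_imp_levelwise\<close>; it turns the comparison of the tails back
  into an equality of values.\<close>

lemma levelwise_sound: "levelwise u v \<Longrightarrow> u \<in> lists A \<Longrightarrow> v \<in> lists A \<Longrightarrow> u \<sim> v"
proof (induction rule: levelwise.induct)
  case (levelwise_step h h' a r r')
  then have "r \<sim> r'" "[a] \<sim> [a]" by (auto intro: pres_cong.refl)
  then have "h @ [a] @ r \<sim> h' @ [a] @ r'" using levelwise_step.hyps(2) cong_append by blast
  then show ?case by simp
qed

end

locale split_presentation = special_presentation A W for A :: "'a set" and W +
  fixes B :: "'a list set set"
  assumes finite_B: "finite B" and B_Units: "B \<subseteq> Units pm" and one_B: "idm \<in> B"
    and inv_B: "b \<in> B \<Longrightarrow> uinv b \<in> B"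
    and Omega_B: "val ` Omega \<inter> Units pm \<subseteq> B"
    and prime_B: "prime p \<Longrightarrow> val p \<in> B"
    and split_B: "\<And>ss. set ss \<subseteq> val ` Collect prime \<union> uinv ` (val ` Collect prime) \<Longrightarrow> 2 \<le> length ss \<Longrightarrow>
      foldr (\<cdot>) ss idm \<in> B \<Longrightarrow> \<exists>xs ys. ss = xs @ ys \<and> xs \<noteq> [] \<and> ys \<noteq> [] \<and> 
        foldr (\<cdot>) xs idm \<in> B \<and> foldr (\<cdot>) ys idm \<in> B"
begin

interpretation M: monoid pm by (rule monoid_presented_monoid)

interpretation U: group "units_of pm" by (rule M.units_group)

definition Q where "Q = B \<union> val ` Omega"

lemma finite_Q: "finite Q"
  unfolding Q_def using finite_B finite_Omega by blast

lemma primes_split: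
  assumes "\<forall>p\<in>set ps. prime p" "2 \<le> length ps" "val (concat ps) \<in> B"
  obtains qs rs where "ps = qs @ rs" "qs \<noteq> []" "rs \<noteq> []" "val (concat qs) \<in> B" "val (concat rs) \<in> B"
proof -
  have "set (map val ps) \<subseteq> val ` Collect prime \<union> uinv ` (val ` Collect prime)"
    using assms(1) by auto
  moreover have "2 \<le> length (map val ps)" using assms(2) by simp
  moreover have "foldr (\<cdot>) (map val ps) idm \<in> B" 
    unfolding foldr_val_primes[OF assms(1)] by (rule assms(3))
  ultimately have "\<exists>xs ys. map val ps = xs @ ys \<and> xs \<noteq> [] \<and> ys \<noteq> [] \<and> 
      foldr (\<cdot>) xs idm \<in> B \<and> foldr (\<cdot>) ys idm \<in> B" by (rule split_B)
  then obtain xs ys where xy: "map val ps = xs @ ys" "xs \<noteq> []" "ys \<noteq> []" 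
    "foldr (\<cdot>) xs idm \<in> B" "foldr (\<cdot>) ys idm \<in> B" by blast
  obtain qs rs where qr: "ps = qs @ rs" "xs = map val qs" "ys = map val rs"
    using xy(1) unfolding map_eq_append_conv by blast
  have "\<forall>p\<in>set qs. prime p" "\<forall>p\<in>set rs. prime p" using assms(1) qr(1) by auto
  from this[THEN foldr_val_primes] show thesis using that[OF qr(1)] xy qr by simp
qed

lemma concat_primes_nonempty: "\<forall>p\<in>set ps. prime p \<Longrightarrow> ps \<noteq> [] \<Longrightarrow> concat ps \<noteq> []"
  by (cases ps) (auto simp: prime_def)

text \<open>An invertible word with at least two primes is cut between primes by
  \<open>split_B\<close>, and a prime is cut after its first letter, since it is good. A word that
  is not invertible equals some word of \<open>Omega\<close>; compared level by level, its unit
  prefix, its next letter and its tail have the values of factors of that word, so it is cut after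
  the unit prefix, or after the first letter if this prefix is empty.\<close>

lemma Q_split:
  assumes u: "u \<in> lists A" "2 \<le> length u" "val u \<in> Q"
  shows "\<exists>x y. u = x @ y \<and> x \<noteq> [] \<and> y \<noteq> [] \<and> val x \<in> Q \<and> val y \<in> Q"
proof (cases "invertible u")
  case True
  then obtain ps where ps: "u = concat ps" "\<forall>p\<in>set ps. prime p" by (rule prime_list)
  show ?thesis
  proof (cases "2 \<le> length ps")
    case len: True
    have "val u \<in> B" using u(3) val_Units[OF u(1)] True Omega_B unfolding Q_def by blast
    then obtain qs rs where qr: "ps = qs @ rs" "qs \<noteq> []" "rs \<noteq> []" "val (concat qs) \<in> B" "val (concat rs) \<in> B"
      using primes_split[OF ps(2) len] ps(1) by blast
    have "\<forall>p\<in>set qs. prime p" "\<forall>p\<in>set rs. prime p" using ps(2) qr(1) by auto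
    then have "concat qs \<noteq> []" "concat rs \<noteq> []" using concat_primes_nonempty qr by blast+
    then show ?thesis using qr ps(1) unfolding Q_def 
      by (intro exI[of _ "concat qs"] exI[of _ "concat rs"]) simp
  next
    case False
    then have "ps = [] \<or> (\<exists>p. ps = [p])" by (cases ps; cases "tl ps") auto
    then have "prime u" using ps u(2) by auto
    then obtain a z z' where z: "u = a # z" "z \<sim> z'" "a # z' \<in> Omega" using prime_good unfolding good_def by blast
    then have "[a] \<in> Omega" "z' \<in> Omega" using Omega_factor[of "[a]" z'] by auto
    moreover have "val z = val z'" using val_eq_iff z(2) cong_lists[OF z(2)] by blast
    ultimately have "val [a] \<in> Q" "val z \<in> Q" unfolding Q_def by auto
    then show ?thesis using z(1) u(2) by (intro exI[of _ "[a]"] exI[of _ z]) auto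
  qed
next
  case False
  then have "val u \<notin> Units pm" using val_Units[OF u(1)] by blast
  then obtain w where w: "w \<in> Omega" "val u = val w" using u(3) B_Units unfolding Q_def by blast
  then have "u \<sim> w" using val_eq_iff u(1) Omega_lists by blast
  then have "levelwise u w" by (rule cong_imp_levelwise)
  then show ?thesis
  proof cases
    case levelwise_unit
    then show ?thesis using False by blast
  next
    case (levelwise_step h h' a r r')
    have O: "h' \<in> Omega" "a # r' \<in> Omega" "[a] \<in> Omega" "r' \<in> Omega"
      using w(1) Omega_factor[of h' "a # r'"] Omega_factor[of "[a]" r'] unfolding levelwise_step(2) by auto
    have hl: "h \<in> lists A" "h' \<in> lists A" using cong_lists[OF \<open>h \<sim> h'\<close>] by auto
    have "a # r \<in> lists A" "w \<in> lists A" using u(1) w(1) Omega_lists levelwise_step(1) by auto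
    then have al: "a # r \<in> lists A" "a # r' \<in> lists A" "r \<in> lists A" "r' \<in> lists A" "[a] \<in> lists A"
      using levelwise_step(2) by auto
    have "r \<sim> r'" using levelwise_sound[OF \<open>levelwise r r'\<close>] al by blast
    then have v: "val h = val h'" "val r = val r'" using val_eq_iff hl al \<open>h \<sim> h'\<close> by blast+
    have "val (a # r) = val [a] \<cdot> val r" "val (a # r') = val [a] \<cdot> val r'"
      using canonical_append[OF al(5,3)] canonical_append[OF al(5,4)] by simp_all
    then have va: "val (a # r) = val (a # r')" using v(2) by simp
    show ?thesis
    proof (cases "h = []")
      case True
      then have "r \<noteq> []" using u(2) levelwise_step(1) by auto
      then show ?thesis using True levelwise_step(1) O v unfolding Q_def
        by (intro exI[of _ "[a]"] exI[of _ r]) auto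
    next
      case False
      then show ?thesis using levelwise_step(1) O v(1) va unfolding Q_def
        by (intro exI[of _ h] exI[of _ "a # r"]) auto
    qed
  qed
qed

section \<open>Deciding membership by closed sets of facts\<close>

text \<open>\<open>gpath n R x u z\<close>: a path labelled \<open>u\<close> from \<open>x\<close> to \<open>z\<close> through nodes below \<open>n\<close>. It is used for
  two graphs: the states of the automaton, and the codes of the suffixes of the input word.\<close>

fun gpath :: "nat \<Rightarrow> (nat \<Rightarrow> 'a \<Rightarrow> nat \<Rightarrow> bool) \<Rightarrow> nat \<Rightarrow> 'a list \<Rightarrow> nat \<Rightarrow> bool" where
  "gpath n R x [] z \<longleftrightarrow> x = z \<and> x < n"
| "gpath n R x (a # u) z \<longleftrightarrow> x < n \<and> (\<exists>y. R x a y \<and> gpath n R y u z)"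

lemma gpath_append: "gpath n R x (u @ v) z \<longleftrightarrow> (\<exists>y. gpath n R x u y \<and> gpath n R y v z)"
proof (induction u arbitrary: x)
  case Nil
  then show ?case by (cases v) auto
qed auto

lemma gpath_bound: "gpath n R x u z \<Longrightarrow> x < n \<and> z < n"
  by (induction u arbitrary: x) auto

text \<open>Multiplication enters as a fixed finite table: the condition on the product is part of
  the range of \<open>d\<close>, so values run over finite sets and nothing is computed in the
  monoid.\<close>

definition word_facts where
  "word_facts n R P \<longleftrightarrow> (\<forall>x<n. P x x idm) \<and> (\<forall>a\<in>A. \<forall>x<n. \<forall>y<n. R x a y \<longrightarrow> P x y (val [a])) \<and>
     (\<forall>c\<in>Q. \<forall>d\<in>{d \<in> Q. c \<cdot> d \<in> Q}. \<forall>x<n. \<forall>y<n. \<forall>z<n. P x y c \<longrightarrow> P y z d \<longrightarrow> P x z (c \<cdot> d))"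

lemma word_facts_mul:
  assumes "word_facts n R P" "c \<in> Q" "d \<in> Q" "c \<cdot> d \<in> Q" "x < n" "y < n" "z < n" "P x y c" "P y z d"
  shows "P x z (c \<cdot> d)"
proof -
  have "d \<in> {d \<in> Q. c \<cdot> d \<in> Q}" using assms(3,4) by simp
  then show ?thesis using assms unfolding word_facts_def by blast
qed

text \<open>Induction on the length: \<open>Q_split\<close> cuts a long word into shorter ones with
  values in \<open>Q\<close>, whose facts the product rule combines.\<close>

lemma word_facts_complete:
  assumes P: "word_facts n R P"
  shows "u \<in> lists A \<Longrightarrow> gpath n R x u z \<Longrightarrow> val u \<in> Q \<Longrightarrow> P x z (val u)"
proof (induction "length u" arbitrary: u x z rule: less_induct)
  case less
  consider "u = []" | a where "u = [a]" | "2 \<le> length u" by (cases u; cases "tl u") auto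
  then show ?case
  proof cases
    case 1
    then show ?thesis using less.prems P unfolding word_facts_def by (simp add: canonical_Nil)
  next
    case 2
    then have "x < n" "z < n" "R x a z" "a \<in> A" using less.prems by auto
    then show ?thesis using 2 P unfolding word_facts_def by simp
  next
    case 3
    then obtain v w where vw: "u = v @ w" "v \<noteq> []" "w \<noteq> []" "val v \<in> Q" "val w \<in> Q"
      using Q_split less.prems by blast
    obtain y where y: "gpath n R x v y" "gpath n R y w z" using less.prems vw(1) by (auto simp: gpath_append)
    have l: "v \<in> lists A" "w \<in> lists A" using less.prems vw(1) by auto
    have "P x y (val v)" "P y z (val w)" using less.hyps[of v] less.hyps[of w] vw y l by auto
    moreover have e: "val u = val v \<cdot> val w" using canonical_append[OF l] vw(1) by simp
    ultimately show ?thesis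
      using word_facts_mul[OF P vw(4,5) less.prems(3)[unfolded e], of x y z]
        gpath_bound[OF y(1)] gpath_bound[OF y(2)] by (simp only: e)
  qed
qed

text \<open>The least closed family of facts: it is closed by \<open>word_facts_sound\<close> and
  contained in every closed one by \<open>word_facts_complete\<close>.\<close>

definition sound_word where
  "sound_word n R x y c \<longleftrightarrow> c \<in> Q \<and> (\<exists>u\<in>lists A. gpath n R x u y \<and> val u = c)"

lemma one_Q: "idm \<in> Q"
  unfolding Q_def using one_B by blast

lemma letter_Q: "a \<in> A \<Longrightarrow> val [a] \<in> Q"
  unfolding Q_def Omega_def by blast

lemma word_facts_sound: "word_facts n R (sound_word n R)"
  unfolding word_facts_def
proof (intro conjI allI impI ballI)
  fix x assume "x < n"
  then show "sound_word n R x x idm"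
    unfolding sound_word_def by (intro conjI one_Q bexI[of _ "[]"]) (auto simp: canonical_Nil)
next
  fix a x y assume "a \<in> A" "x < n" "y < n" "R x a y"
  then show "sound_word n R x y (val [a])"
    unfolding sound_word_def by (intro conjI letter_Q bexI[of _ "[a]"]) auto
next
  fix c d x y z assume cd: "d \<in> {d \<in> Q. c \<cdot> d \<in> Q}" and "sound_word n R x y c" "sound_word n R y z d"
  then obtain u v where *: "u \<in> lists A" "v \<in> lists A" "gpath n R x u y" "gpath n R y v z" "val u = c" "val v = d"
    unfolding sound_word_def by blast
  then show "sound_word n R x z (c \<cdot> d)"
    unfolding sound_word_def 
    using canonical_append[OF *(1,2)] cd by (intro conjI bexI[of _ "u @ v"]) (auto simp: gpath_append)
qed

text \<open>\<open>P1 x y c\<close> and \<open>P2 p q c\<close> mean that \<open>c\<close> is the value of the label of some path in the first or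
  second graph; \<open>T x p b\<close> means that a path from \<open>x\<close> to 0 has the same value as \<open>b\<close> times that of
  a path from \<open>p\<close> to a final node.\<close>

definition closed_facts where
  "closed_facts n R1 R2 F P1 P2 T \<longleftrightarrow> word_facts n R1 P1 \<and> word_facts n R2 P2 \<and>
     (\<forall>p<n. F p \<longrightarrow> T 0 p idm) \<and>
     (\<forall>c\<in>B. \<forall>d\<in>{d \<in> B. c \<cdot> d \<in> B}. \<forall>x<n. \<forall>y<n. \<forall>p<n. P1 x y c \<longrightarrow> T y p d \<longrightarrow> T x p (c \<cdot> d)) \<and>
     (\<forall>b\<in>B. \<forall>d\<in>{d \<in> B. b \<cdot> d \<in> B}. \<forall>p<n. \<forall>q<n. \<forall>x<n. P2 p q d \<longrightarrow> T x q (b \<cdot> d) \<longrightarrow> T x p b) \<and>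
     (\<forall>a\<in>A. \<forall>x<n. \<forall>y<n. \<forall>p<n. \<forall>q<n. R1 x a y \<longrightarrow> R2 p a q \<longrightarrow> T y q idm \<longrightarrow> T x p idm)"

text \<open>A segment put in front of the path in the first graph multiplies the unit by its
  value.\<close>

lemma closed_facts_left:
  assumes "closed_facts n R1 R2 F P1 P2 T" "c \<in> B" "d \<in> B" "c \<cdot> d \<in> B" 
    "gpath n R1 x u y" "u \<in> lists A" "val u = c" "T y p d" "p < n"
  shows "T x p (c \<cdot> d)"
proof -
  have "word_facts n R1 P1" using assms(1) unfolding closed_facts_def by (elim conjE)
  then have "P1 x y c" using word_facts_complete[OF _ assms(6,5)] assms(2,7) unfolding Q_def by blast
  moreover have "d \<in> {d \<in> B. c \<cdot> d \<in> B}" using assms(3,4) by simp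
  moreover have "x < n" "y < n" using gpath_bound[OF assms(5)] by auto
  moreover have "\<forall>c\<in>B. \<forall>d\<in>{d \<in> B. c \<cdot> d \<in> B}. \<forall>x<n. \<forall>y<n. \<forall>p<n. P1 x y c \<longrightarrow> T y p d \<longrightarrow> T x p (c \<cdot> d)"
    using assms(1) unfolding closed_facts_def by (elim conjE)
  ultimately show ?thesis using assms(2,8,9) by meson
qed

text \<open>A segment put in front of the path in the second graph takes its value off the unit,
  because \<open>(b \<cdot> d) \<cdot> z\<close> is \<open>b \<cdot> (d \<cdot> z)\<close>.\<close>

lemma closed_facts_right:
  assumes "closed_facts n R1 R2 F P1 P2 T" "b \<in> B" "d \<in> B" "b \<cdot> d \<in> B" 
    "gpath n R2 p v q" "v \<in> lists A" "val v = d" "T x q (b \<cdot> d)" "x < n"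
  shows "T x p b"
proof -
  have "word_facts n R2 P2" using assms(1) unfolding closed_facts_def by (elim conjE)
  then have "P2 p q d" using word_facts_complete[OF _ assms(6,5)] assms(3,7) unfolding Q_def by blast
  moreover have "d \<in> {d \<in> B. b \<cdot> d \<in> B}" using assms(3,4) by simp
  moreover have "p < n" "q < n" using gpath_bound[OF assms(5)] by auto
  moreover have "\<forall>b\<in>B. \<forall>d\<in>{d \<in> B. b \<cdot> d \<in> B}. \<forall>p<n. \<forall>q<n. \<forall>x<n. P2 p q d \<longrightarrow> T x q (b \<cdot> d) \<longrightarrow> T x p b"
    using assms(1) unfolding closed_facts_def by (elim conjE)
  ultimately show ?thesis using assms(2,8,9) by meson
qed

section \<open>Derivation of all true facts\<close>

lemma foldr_uinv_primes:
  assumes "\<forall>p\<in>set qs. prime p"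
  shows "foldr (\<cdot>) (map uinv (rev (map val qs))) idm = uinv (val (concat qs))"
proof -
  have "set (map val qs) \<subseteq> Units pm" using assms prime_val_Units by auto
  from foldr_uinv_rev[OF this] show ?thesis unfolding foldr_val_primes[OF assms] .
qed

lemma concat_primes_Units: "\<forall>p\<in>set ps. prime p \<Longrightarrow> val (concat ps) \<in> Units pm"
  using val_Units[OF concat_prime_lists] concat_prime_invertible by blast

lemma foldr_mixed:
  assumes "\<forall>p\<in>set ps. prime p" "\<forall>p\<in>set qs. prime p"
  shows "foldr (\<cdot>) (map val ps @ map uinv (rev (map val qs))) idm = 
    val (concat ps) \<cdot> uinv (val (concat qs))"
proof -
  have "set (map val ps) \<subseteq> carrier pm" "set (map val qs) \<subseteq> Units pm" 
    using assms prime_val_Units Units_pm_closed by auto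
  moreover have "set (map uinv (rev (map val qs))) \<subseteq> carrier pm" 
    using calculation(2) uinv(1) Units_pm_closed by auto
  ultimately show ?thesis using foldr_mul_append foldr_val_primes[OF assms(1)] foldr_uinv_primes[OF assms(2)]
    by presburger
qed

lemma val_concat_append:
  assumes "\<forall>p\<in>set ps. prime p" "\<forall>p\<in>set qs. prime p"
  shows "val (concat (ps @ qs)) = val (concat ps) \<cdot> val (concat qs)"
  using canonical_append[OF concat_prime_lists[OF assms(1)] concat_prime_lists[OF assms(2)]] by simp

text \<open>The equation says that the primes of \<open>ps\<close>, followed by the inverses of
  those of \<open>qs\<close> in reverse order, have product \<open>b\<close>. As long as there are
  at least two factors, \<open>split_B\<close> cuts this product inside \<open>B\<close>; one of the
  two segment rules removes a piece, and the induction hypothesis treats the rest.\<close>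

lemma closed_facts_primes:
  assumes C: "closed_facts n R1 R2 F P1 P2 T"
  shows "\<forall>p\<in>set ps. prime p \<Longrightarrow> \<forall>p\<in>set qs. prime p \<Longrightarrow> gpath n R1 x (concat ps) y \<Longrightarrow>
    gpath n R2 p (concat qs) q \<Longrightarrow> T y q idm \<Longrightarrow> val (concat ps) = b \<cdot> val (concat qs) \<Longrightarrow> b \<in> B \<Longrightarrow> T x p b"
proof (induction "length ps + length qs" arbitrary: ps qs x p b rule: less_induct)
  case less
  note U = concat_primes_Units[OF less.prems(1)] concat_primes_Units[OF less.prems(2)]
  note Uc = U[THEN Units_pm_closed] uinv(1)[OF U(2), THEN Units_pm_closed]
  have b: "b \<in> Units pm" "b \<in> carrier pm" using less.prems(7) B_Units Units_pm_closed by auto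
  have bnd: "x < n" "y < n" "p < n" "q < n" 
    using gpath_bound[OF less.prems(3)] gpath_bound[OF less.prems(4)] by auto
  have beq: "val (concat ps) \<cdot> uinv (val (concat qs)) = b"
    unfolding less.prems(6) using b Uc uinv(3)[OF U(2)] by (simp add: M.m_assoc)
  consider "ps = []" "qs = []" | p1 where "ps = [p1]" "qs = []" | q1 where "ps = []" "qs = [q1]"
    | "2 \<le> length ps + length qs"
    by (cases ps; cases "tl ps"; cases qs; cases "tl qs") auto
  then show ?case
  proof cases
    case 1
    then have "b = idm" using less.prems(6) b by (simp add: canonical_Nil)
    then show ?thesis using less.prems(3-5) 1 by simp
  next
    case 2
    have "val p1 = b" using less.prems(6) 2 b by (simp add: canonical_Nil)
    moreover have "gpath n R1 x p1 y" "p = q" "p1 \<in> lists A" 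
      using less.prems(1,3,4) 2 prime_lists by auto
    ultimately have "T x p (b \<cdot> idm)"
      using closed_facts_left[OF C less.prems(7) one_B, of x p1 y p] less.prems(5,7) b bnd by simp
    then show ?thesis using b by simp
  next
    case 3
    have q1: "prime q1" "q1 \<in> lists A" "gpath n R2 p q1 q" "x = y" 
      using less.prems(2,3,4) 3 prime_lists by auto
    have "b \<cdot> val q1 = idm" using less.prems(6) 3 by (simp add: canonical_Nil)
    then show ?thesis
      using closed_facts_right[OF C less.prems(7) prime_B[OF q1(1)] _ q1(3,2) HOL.refl, of x] less.prems(5) q1(4) bnd one_B by simp
  next
    case 4
    let ?ss = "map val ps @ map uinv (rev (map val qs))"
    have "set ?ss \<subseteq> val ` Collect prime \<union> uinv ` (val ` Collect prime)"
      using less.prems(1,2) by auto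
    moreover have "2 \<le> length ?ss" using 4 by simp
    moreover have "foldr (\<cdot>) ?ss idm \<in> B" 
      unfolding foldr_mixed[OF less.prems(1,2)] beq by (rule less.prems(7))
    ultimately have "\<exists>xs ys. ?ss = xs @ ys \<and> xs \<noteq> [] \<and> ys \<noteq> [] \<and> 
        foldr (\<cdot>) xs idm \<in> B \<and> foldr (\<cdot>) ys idm \<in> B" by (rule split_B)
    then obtain xs ys where xy: "?ss = xs @ ys" "xs \<noteq> []" "ys \<noteq> []" 
      "foldr (\<cdot>) xs idm \<in> B" "foldr (\<cdot>) ys idm \<in> B" by blast
    from xy(1) obtain us where "map val ps = xs @ us \<and> us @ map uinv (rev (map val qs)) = ys \<or>
        map val ps @ us = xs \<and> map uinv (rev (map val qs)) = us @ ys"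
      unfolding append_eq_append_conv2 by blast
    then show ?thesis
    proof
      \<comment> \<open>The cut falls into \<open>ps\<close>, and the initial segment
        \<open>ps1\<close> is removed from the first path.\<close>
      assume us: "map val ps = xs @ us \<and> us @ map uinv (rev (map val qs)) = ys"
      then obtain ps1 ps2 where ps: "ps = ps1 @ ps2" "xs = map val ps1" "us = map val ps2"
        unfolding map_eq_append_conv by blast
      have pr: "\<forall>p\<in>set ps1. prime p" "\<forall>p\<in>set ps2. prime p" using less.prems(1) ps(1) by auto
      have c: "val (concat ps1) \<in> B" using xy(4) unfolding ps(2) foldr_val_primes[OF pr(1)] .
      let ?d = "val (concat ps2) \<cdot> uinv (val (concat qs))"
      have d: "?d \<in> B"
        using xy(5) us unfolding ps(3) using foldr_mixed[OF pr(2) less.prems(2)] by metis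
      note U1 = concat_primes_Units[OF pr(1)] concat_primes_Units[OF pr(2)]
      note U1c = U1[THEN Units_pm_closed]
      have cd: "val (concat ps1) \<cdot> ?d = b"
        using beq unfolding ps(1) val_concat_append[OF pr] using U1c Uc by (simp add: M.m_assoc)
      obtain z where z: "gpath n R1 x (concat ps1) z" "gpath n R1 z (concat ps2) y"
        using less.prems(3) ps(1) by (auto simp: gpath_append)
      have "length ps1 > 0" using xy(2) ps(2) by auto
      then have len: "length ps2 + length qs < length ps + length qs" using ps(1) by simp
      have "val (concat ps2) = ?d \<cdot> val (concat qs)"
        using U1c Uc uinv(2)[OF U(2)] by (simp add: M.m_assoc)
      then have "T z p ?d" 
        using less.hyps[OF len pr(2) less.prems(2) z(2) less.prems(4,5)] d by blast
      then have "T x p (val (concat ps1) \<cdot> ?d)"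
        using closed_facts_left[OF C c d _ z(1) concat_prime_lists[OF pr(1)] HOL.refl] cd less.prems(7) bnd by simp
      then show ?thesis unfolding cd .
    next
      \<comment> \<open>The cut falls among the inverses. These are in reverse order, so the right
        part \<open>ys\<close> comes from the initial segment \<open>qs1\<close>, which is removed
        from the second path.\<close>
      assume us: "map val ps @ us = xs \<and> map uinv (rev (map val qs)) = us @ ys"
      then obtain l1 l2 where l: "rev (map val qs) = l1 @ l2" "us = map uinv l1" "ys = map uinv l2"
        unfolding map_eq_append_conv[of uinv] by blast
      have "map val qs = rev l2 @ rev l1" using arg_cong[OF l(1), of rev] by simp
      then obtain qs1 qs2 where qs: "qs = qs1 @ qs2" "rev l2 = map val qs1" "rev l1 = map val qs2"
        unfolding map_eq_append_conv by blast
      have l12: "l2 = rev (map val qs1)" "l1 = rev (map val qs2)" 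
        using arg_cong[OF qs(2), of rev] arg_cong[OF qs(3), of rev] by simp_all
      have pr: "\<forall>p\<in>set qs1. prime p" "\<forall>p\<in>set qs2. prime p" using less.prems(2) qs(1) by auto
      note U1 = concat_primes_Units[OF pr(1)] concat_primes_Units[OF pr(2)]
      note U1c = U1[THEN Units_pm_closed] uinv(1)[OF U1(2), THEN Units_pm_closed] 
      let ?c = "val (concat ps) \<cdot> uinv (val (concat qs2))"
      let ?d = "val (concat qs1)"
      have c: "?c \<in> B" 
        using xy(4) us unfolding l(2) l12 using foldr_mixed[OF less.prems(1) pr(2)] by metis
      have "uinv ?d \<in> B" using xy(5) unfolding l(3) l12 foldr_uinv_primes[OF pr(1)] .
      \<comment> \<open>The cut supplies the inverse of \<open>?d\<close>, while the segment rule
        asks for \<open>?d\<close> itself.\<close>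
      then have "uinv (uinv ?d) \<in> B" by (rule inv_B)
      then have d: "?d \<in> B" using U.inv_inv[of ?d] U1(1) by (simp add: units_of_carrier)
      have bd: "b \<cdot> ?d = ?c"
        unfolding less.prems(6) qs(1) val_concat_append[OF pr] 
        using b U1c uinv(3)[OF U1(2)] by (simp add: M.m_assoc)
      obtain p' where p': "gpath n R2 p (concat qs1) p'" "gpath n R2 p' (concat qs2) q"
        using less.prems(4) qs(1) by (auto simp: gpath_append)
      have "length qs1 > 0" using xy(3) unfolding l(3) l12 by auto
      then have len: "length ps + length qs2 < length ps + length qs" using qs(1) by simp
      have "val (concat ps) = ?c \<cdot> val (concat qs2)"
        using Uc U1c uinv(2)[OF U1(2)] by (simp add: M.m_assoc)
      then have "T x p' ?c" 
        using less.hyps[OF len less.prems(1) pr(2) less.prems(3) p'(2) less.prems(5)] c by blast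
      then have "T x p' (b \<cdot> ?d)" unfolding bd .
      then show ?thesis
        using closed_facts_right[OF C less.prems(7) d _ p'(1) concat_prime_lists[OF pr(1)] HOL.refl] bd c bnd by simp
    qed
  qed
qed

lemma closed_facts_unit:
  assumes C: "closed_facts n R1 R2 F P1 P2 T" and h: "invertible h" "h \<sim> h'"
    and path: "gpath n R1 x h y" "gpath n R2 p h' q" and T: "T y q idm"
  shows "T x p idm"
proof -
  have h': "invertible h'" using invertible_cong[OF h(2,1)] .
  obtain ps where ps: "h = concat ps" "\<forall>p\<in>set ps. prime p" using h(1) by (rule prime_list)
  obtain qs where qs: "h' = concat qs" "\<forall>p\<in>set qs. prime p" using h' by (rule prime_list)
  have l: "h \<in> lists A" "h' \<in> lists A" using invertible_lists h(1) h' by blast+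
  have "val h = idm \<cdot> val h'" using val_eq_iff[OF l] h(2) val_closed[OF l(2)] by simp
  then show ?thesis
    using closed_facts_primes[OF C ps(2) qs(2) path[unfolded ps(1) qs(1)] T _ one_B] ps(1) qs(1) by simp
qed

text \<open>The levels are worked off from the end of the words: the fact at the final node starts
  the derivation, a common letter is read in both graphs, and \<open>closed_facts_unit\<close>
  handles the unit prefixes.\<close>

lemma closed_facts_complete:
  assumes C: "closed_facts n R1 R2 F P1 P2 T"
  shows "levelwise u v \<Longrightarrow> u \<in> lists A \<Longrightarrow> gpath n R1 x u 0 \<Longrightarrow> gpath n R2 p v f \<Longrightarrow> F f \<Longrightarrow> T x p idm"
proof (induction arbitrary: x p rule: levelwise.induct)
  case (levelwise_unit u v)
  have "f < n" using gpath_bound[OF levelwise_unit.prems(3)] by simp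
  then have "T 0 f idm" using C levelwise_unit.prems(4) unfolding closed_facts_def by blast
  then show ?case by (rule closed_facts_unit[OF C levelwise_unit.hyps levelwise_unit.prems(2,3)])
next
  case (levelwise_step h h' a r r')
  obtain y y' where y: "gpath n R1 x h y" "R1 y a y'" "gpath n R1 y' r 0"
    using levelwise_step.prems(2) by (auto simp: gpath_append)
  obtain q q' where q: "gpath n R2 p h' q" "R2 q a q'" "gpath n R2 q' r' f"
    using levelwise_step.prems(3) by (auto simp: gpath_append)
  have "T y' q' idm" using levelwise_step.IH[OF _ y(3) q(3) levelwise_step.prems(4)] levelwise_step.prems(1) by auto
  moreover have "y < n" "y' < n" "q < n" "q' < n"
    using gpath_bound[OF y(1)] gpath_bound[OF y(3)] gpath_bound[OF q(1)] gpath_bound[OF q(3)] by auto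
  moreover have "\<forall>a\<in>A. \<forall>x<n. \<forall>y<n. \<forall>p<n. \<forall>q<n. R1 x a y \<longrightarrow> R2 p a q \<longrightarrow> T y q idm \<longrightarrow> T x p idm"
    using C unfolding closed_facts_def by (elim conjE)
  ultimately have "T y q idm" using y(2) q(2) levelwise_step.hyps(3) by simp
  then show ?case by (rule closed_facts_unit[OF C levelwise_step.hyps(1,2) y(1) q(1)])
qed

section \<open>The true facts form a closed set\<close>

definition sound_pair where
  "sound_pair n R1 R2 F x p b \<longleftrightarrow> b \<in> B \<and> (\<exists>u\<in>lists A. \<exists>v\<in>lists A. \<exists>f. F f \<and> gpath n R1 x u 0 \<and> 
     gpath n R2 p v f \<and> val u = b \<cdot> val v)"

lemma sound_pairI:
  "b \<in> B \<Longrightarrow> u \<in> lists A \<Longrightarrow> v \<in> lists A \<Longrightarrow> F f \<Longrightarrow> gpath n R1 x u 0 \<Longrightarrow> gpath n R2 p v f \<Longrightarrow> val u = b \<cdot> val v 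
   \<Longrightarrow> sound_pair n R1 R2 F x p b"
  unfolding sound_pair_def by blast

lemma closed_facts_sound:
  assumes "0 < n"
  shows "closed_facts n R1 R2 F (sound_word n R1) (sound_word n R2) (sound_pair n R1 R2 F)"
  unfolding closed_facts_def
proof (intro conjI allI impI ballI word_facts_sound)
  \<comment> \<open>The empty path at node 0 requires that 0 is a node, which is
    \<open>0 < n\<close>.\<close>
  fix p assume "p < n" "F p"
  then show "sound_pair n R1 R2 F 0 p idm"
    using assms one_B by (intro sound_pairI[of _ "[]" "[]"]) (auto simp: canonical_Nil)
next
  fix c d x y p
  assume B: "c \<in> B" "d \<in> {d \<in> B. c \<cdot> d \<in> B}" and "sound_word n R1 x y c" "sound_pair n R1 R2 F y p d"
  then obtain w u v f where *: "w \<in> lists A" "gpath n R1 x w y" "val w = c" "u \<in> lists A" "v \<in> lists A"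
    "F f" "gpath n R1 y u 0" "gpath n R2 p v f" "val u = d \<cdot> val v"
    unfolding sound_word_def sound_pair_def by blast
  have "c \<in> carrier pm" "d \<in> carrier pm" "val v \<in> carrier pm" 
    using B B_Units Units_pm_closed val_closed[OF *(5)] by auto
  then have "val (w @ u) = (c \<cdot> d) \<cdot> val v" 
    using canonical_append[OF *(1,4)] *(3,9) by (simp add: M.m_assoc)
  then show "sound_pair n R1 R2 F x p (c \<cdot> d)"
    using * B by (intro sound_pairI[of _ "w @ u" v F f]) (auto simp: gpath_append)
next
  fix b d p q x
  assume B: "b \<in> B" "d \<in> {d \<in> B. b \<cdot> d \<in> B}" and "sound_word n R2 p q d" "sound_pair n R1 R2 F x q (b \<cdot> d)"
  then obtain w u v f where *: "w \<in> lists A" "gpath n R2 p w q" "val w = d" "u \<in> lists A" "v \<in> lists A"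
    "F f" "gpath n R1 x u 0" "gpath n R2 q v f" "val u = (b \<cdot> d) \<cdot> val v"
    unfolding sound_word_def sound_pair_def by blast
  have "b \<in> carrier pm" "d \<in> carrier pm" "val v \<in> carrier pm" 
    using B B_Units Units_pm_closed val_closed[OF *(5)] by auto
  then have "val u = b \<cdot> val (w @ v)" 
    using canonical_append[OF *(1,5)] *(3,9) by (simp add: M.m_assoc)
  then show "sound_pair n R1 R2 F x p b"
    using * B by (intro sound_pairI[of _ u "w @ v" F f]) (auto simp: gpath_append)
next
  fix a x y p q
  assume a: "a \<in> A" "x < n" "p < n" "R1 x a y" "R2 p a q" and "sound_pair n R1 R2 F y q idm"
  then obtain u v f where *: "u \<in> lists A" "v \<in> lists A"
    "F f" "gpath n R1 y u 0" "gpath n R2 q v f" "val u = idm \<cdot> val v"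
    unfolding sound_pair_def by blast
  have al: "[a] \<in> lists A" using a(1) by simp
  have "val u = val v" using *(6) val_closed[OF *(2)] by simp
  then have "val (a # u) = val (a # v)"
    using canonical_append[OF al *(1), of "special_rels W"] canonical_append[OF al *(2), of "special_rels W"] by simp
  moreover have "a # v \<in> lists A" using a(1) *(2) by simp
  ultimately have "val (a # u) = idm \<cdot> val (a # v)" using val_closed[of "a # v"] by simp
  then show "sound_pair n R1 R2 F x p idm"
    using * a one_B by (intro sound_pairI[of _ "a # u" "a # v" F f]) auto
qed

section \<open>Coding of the two graphs and of sets of facts\<close>

text \<open>An edge removes the head of a coded list, so the paths from a word code to 0 spell the
  word.\<close>

definition word_edge :: "('a \<Rightarrow> nat) \<Rightarrow> nat \<Rightarrow> 'a \<Rightarrow> nat \<Rightarrow> bool" where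
  "word_edge e x a y \<longleftrightarrow> x = Suc (prod_encode (e a, y))"

definition nfa_edge :: "('a \<Rightarrow> nat) \<Rightarrow> nat \<Rightarrow> nat \<Rightarrow> 'a \<Rightarrow> nat \<Rightarrow> bool" where
  "nfa_edge e N p a q \<longleftrightarrow> prod_encode (p, prod_encode (e a, q)) \<in> set (list_decode (fst (prod_decode N)))"

definition code_initial where
  "code_initial N p \<longleftrightarrow> p \<in> set (list_decode (fst (prod_decode (snd (prod_decode N)))))"

definition code_final where
  "code_final N p \<longleftrightarrow> p \<in> set (list_decode (snd (prod_decode (snd (prod_decode N)))))"

text \<open>The residue modulo 3 tells the three kinds of facts apart, so that one number codes all
  three relations.\<close>

definition fact_code :: "('a list set \<Rightarrow> nat) \<Rightarrow> nat \<Rightarrow> nat \<Rightarrow> nat \<Rightarrow> 'a list set \<Rightarrow> nat" where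
  "fact_code ix k x y c = prod_encode (3 * ix c + k, prod_encode (x, y))"

text \<open>The numbering \<open>ix\<close> is to be injective on \<open>Q\<close> only, hence the
  guard.\<close>

definition in_code where
  "in_code ix k S x y c \<longleftrightarrow> c \<in> Q \<and> fact_code ix k x y c \<in> set_decode S"

definition closed_code where
  "closed_code e ix S w N \<longleftrightarrow> closed_facts (Suc (w + N)) (word_edge e) (nfa_edge e N) (code_final N)
     (in_code ix 0 S) (in_code ix 1 S) (in_code ix 2 S)"

text \<open>The wanted fact must lie in every closed set. Numbers below the bound code exactly the
  sets of numbers up to the exponent's pair code, where \<open>K\<close> is to bound the first
  components of fact codes and \<open>w + N\<close> all nodes.\<close>

definition accepts_code where
  "accepts_code e ix K w N \<longleftrightarrow>
     (\<forall>S < 2 ^ Suc (prod_encode (K, prod_encode (w + N, w + N))). 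
        closed_code e ix S w N \<longrightarrow> (\<exists>p < Suc (w + N). code_initial N p \<and> in_code ix 2 S w p idm))"

lemmas computable_intros = decid_conj decid_Ball decid_all decid_imp decid_ex decid_eq decid_set_decode
  decid_set_list_decode computable_const computable_var computable_Suc computable_add computable_prod_encode
  computable_fst_decode computable_snd_decode computable_power2

lemma finite_restrict: "finite {d \<in> B. R d}" "finite {d \<in> Q. R d}"
  using finite_B finite_Q by simp_all

text \<open>Quantifiers over letters and values become finite conjunctions and those over nodes are
  bounded. The numberings \<open>e\<close> and \<open>ix\<close> occur only through finitely many
  constants, so nothing about their computability is asked.\<close>

lemma decid_closed_code: "decid (\<lambda>v. closed_code e ix (v 0) (v (Suc 0)) (v (Suc (Suc 0))))"
  unfolding closed_code_def closed_facts_def word_facts_def word_edge_def nfa_edge_def code_final_def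
    in_code_def fact_code_def
  by (intro computable_intros finite_A finite_B finite_Q finite_restrict)

lemma decid_accepts_code: "decid (\<lambda>v. accepts_code e ix K (v 0) (v (Suc 0)))"
  unfolding accepts_code_def code_initial_def in_code_def fact_code_def
  by (intro computable_intros decid_closed_code)

lemma word_code_Cons: "word_code e (a # u) = Suc (prod_encode (e a, word_code e u))"
  by (simp add: word_code_def)

lemma word_code_Nil: "word_code e [] = 0"
  by (simp add: word_code_def)

lemma gpath_word_code: "word_code e u < n \<Longrightarrow> gpath n (word_edge e) (word_code e u) u 0"
proof (induction u)
  case (Cons a u)
  then show ?case using le_prod_encode_2[of "word_code e u" "e a"] 
    by (auto simp: word_code_Cons word_edge_def)
qed (simp add: word_code_Nil)

lemma gpath_word_code_unique: "gpath n (word_edge e) x u 0 \<Longrightarrow> x = word_code e u"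
  by (induction u arbitrary: x) (auto simp: word_code_Nil word_code_Cons word_edge_def)

lemma word_code_inj:
  assumes "inj_on e A" "u \<in> lists A" "v \<in> lists A" "word_code e u = word_code e v" shows "u = v"
proof -
  have "map e u = map e v" using assms(4) inj_list_encode[of UNIV] unfolding word_code_def by (simp add: inj_eq)
  then show ?thesis using assms(1-3) inj_on_map_lists[of e A] by (meson inj_onD inj_on_mapI lists_eq_set)
qed

lemma mem_le_list_encode: "x \<in> set xs \<Longrightarrow> x \<le> list_encode xs"
proof (induction xs)
  case (Cons a xs)
  then show ?case using le_prod_encode_1[of a "list_encode xs"] le_prod_encode_2[of "list_encode xs" a] by auto
qed simp

lemma nfa_edge_iff:
  assumes "inj_on e A" "nfa_over A K" "a \<in> A"
  shows "nfa_edge e (nfa_code e K) p a q \<longleftrightarrow> (p, a, q) \<in> set (transitions K)"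
proof -
  have "nfa_edge e (nfa_code e K) p a q \<longleftrightarrow> (\<exists>b. (p, b, q) \<in> set (transitions K) \<and> e a = e b)"
    unfolding nfa_edge_def nfa_code_def by (force simp: prod_encode_eq)
  also have "\<dots> \<longleftrightarrow> (p, a, q) \<in> set (transitions K)"
    using assms unfolding nfa_over_def by (force dest: inj_onD)
  finally show ?thesis .
qed

lemma code_initial_iff: "code_initial (nfa_code e K) p \<longleftrightarrow> p \<in> set (initials K)"
  by (simp add: code_initial_def nfa_code_def)

lemma code_final_iff: "code_final (nfa_code e K) p \<longleftrightarrow> p \<in> set (finals K)"
  by (simp add: code_final_def nfa_code_def)

lemma initials_le: "p \<in> set (initials K) \<Longrightarrow> p \<le> nfa_code e K"
  unfolding nfa_code_def 
  by (meson mem_le_list_encode le_prod_encode_1 le_prod_encode_2 le_trans)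

lemma finals_le: "p \<in> set (finals K) \<Longrightarrow> p \<le> nfa_code e K"
  unfolding nfa_code_def 
  by (meson mem_le_list_encode le_prod_encode_1 le_prod_encode_2 le_trans)

lemma transitions_le: 
  assumes "(p, a, q) \<in> set (transitions K)" shows "p \<le> nfa_code e K"
proof -
  have "prod_encode (p, prod_encode (e a, q)) \<in> set (map (\<lambda>(p, a, q). prod_encode (p, prod_encode (e a, q))) (transitions K))"
    using assms by force
  then show ?thesis unfolding nfa_code_def 
    by (meson mem_le_list_encode le_prod_encode_1 le_trans)
qed

lemma run_lists: "run K p v f \<Longrightarrow> nfa_over A K \<Longrightarrow> v \<in> lists A"
  by (induction rule: run.induct) (auto simp: nfa_over_def)

text \<open>The source of every transition is at most the code of the automaton, so the bound on
  nodes could fail only at the last state, where \<open>f < n\<close> provides it.\<close>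

lemma run_iff_gpath:
  assumes "inj_on e A" "nfa_over A K" "nfa_code e K < n"
  shows "v \<in> lists A \<Longrightarrow> f < n \<Longrightarrow> run K p v f \<longleftrightarrow> gpath n (nfa_edge e (nfa_code e K)) p v f"
proof (induction v arbitrary: p)
  case Nil
  then show ?case by (auto intro: run.Nil elim: run.cases)
next
  case (Cons a v)
  have "run K p (a # v) f \<longleftrightarrow> (\<exists>q. (p, a, q) \<in> set (transitions K) \<and> run K q v f)"
    by (subst run.simps) simp
  also have "\<dots> \<longleftrightarrow> (\<exists>q. p < n \<and> (p, a, q) \<in> set (transitions K) \<and> run K q v f)"
    using le_less_trans[OF transitions_le assms(3)] by blast
  also have "\<dots> \<longleftrightarrow> gpath n (nfa_edge e (nfa_code e K)) p (a # v) f"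
    using Cons nfa_edge_iff[OF assms(1,2), of a] by auto
  finally show ?case .
qed

text \<open>An accepted word of the same value agrees with \<open>w\<close> level by level, so every
  closed set contains the fact for its run.\<close>

lemma accepts_code_complete:
  assumes e: "inj_on e A" and K: "nfa_over A K" and w: "w \<in> lists A" and "val w \<in> val ` language K"
  shows "accepts_code e ix M (word_code e w) (nfa_code e K)"
proof -
  let ?w = "word_code e w" and ?N = "nfa_code e K"
  let ?n = "Suc (?w + ?N)"
  obtain v where v: "v \<in> language K" "val w = val v" using assms(4) by blast
  obtain p f where pf: "p \<in> set (initials K)" "f \<in> set (finals K)" "run K p v f"
    using v(1) unfolding language_def by blast
  have vl: "v \<in> lists A" using run_lists[OF pf(3) K] .
  have fn: "f < ?n" and pn: "p < ?n" using finals_le[OF pf(2), of e] initials_le[OF pf(1), of e] by auto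
  have p2: "gpath ?n (nfa_edge e ?N) p v f" using run_iff_gpath[OF e K _ vl fn, of p] pf(3) by simp
  have p1: "gpath ?n (word_edge e) ?w w 0" by (rule gpath_word_code) simp
  have levelwise: "levelwise w v" using v(2) val_eq_iff[OF w vl] cong_imp_levelwise by blast
  have F: "code_final ?N f" using pf(2) by (simp add: code_final_iff)
  have "\<exists>p < ?n. code_initial ?N p \<and> in_code ix 2 S ?w p idm" if "closed_code e ix S ?w ?N" for S
  proof -
    have "in_code ix 2 S ?w p idm" 
      by (rule closed_facts_complete[OF that[unfolded closed_code_def] levelwise w p1 p2 F])
    then show ?thesis using pn pf(1) code_initial_iff by blast
  qed
  then show ?thesis unfolding accepts_code_def by blast
qed

lemma prod_encode_mono: "a \<le> a' \<Longrightarrow> b \<le> b' \<Longrightarrow> prod_encode (a, b) \<le> prod_encode (a', b')"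
proof -
  have "triangle m \<le> triangle n" if "m \<le> n" for m n
    using that by (induction rule: dec_induct) auto
  then show "a \<le> a' \<Longrightarrow> b \<le> b' \<Longrightarrow> ?thesis"
    by (simp add: prod_encode_def add_mono)
qed

lemma fact_code_eqD:
  assumes "fact_code ix k x y c = fact_code ix k' x' y' c'" "inj_on ix Q" "c \<in> Q" "c' \<in> Q" "k < 3" "k' < 3"
  shows "k = k' \<and> x = x' \<and> y = y' \<and> c = c'"
proof -
  have eq: "3 * ix c + k = 3 * ix c' + k'" "x = x'" "y = y'" 
    using assms(1) unfolding fact_code_def by (auto simp: prod_encode_eq)
  then have "k = k'" "ix c = ix c'" using assms(5,6) by presburger+
  then show ?thesis using eq assms(2-4) inj_onD by metis
qed

text \<open>Realises bounded relations by one number below the bound, so that the quantifier over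
  \<open>S\<close> can be instantiated with the true facts.\<close>

lemma code_facts:
  assumes ix: "inj_on ix Q" and M: "\<And>c. c \<in> Q \<Longrightarrow> 3 * ix c + 2 \<le> M"
    and P: "\<And>k x y c. P k x y c \<Longrightarrow> c \<in> Q \<and> k < (3::nat) \<and> x < Suc n \<and> y < Suc n"
  obtains S where "S < 2 ^ Suc (prod_encode (M, prod_encode (n, n)))" "\<And>k. k < 3 \<Longrightarrow> in_code ix k S = P k"
proof -
  let ?m = "prod_encode (M, prod_encode (n, n))"
  define F where "F = {fact_code ix k x y c | k x y c. P k x y c}"
  have "z \<le> ?m" if zF: "z \<in> F" for z
  proof -
    obtain k x y c where z: "z = fact_code ix k x y c" "P k x y c" using zF unfolding F_def by blast
    have "3 * ix c + k \<le> M" "x \<le> n" "y \<le> n" using P[OF z(2)] M[of c] by auto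
    then show ?thesis unfolding z(1) fact_code_def by (intro prod_encode_mono)
  qed
  then have F: "F \<subseteq> {..<Suc ?m}" by (auto simp: less_Suc_eq_le)
  then have fin: "finite F" by (rule finite_subset) simp
  have "set_encode F < 2 ^ Suc ?m"
  proof -
    have "set_encode F \<le> set_encode {..<Suc ?m}"
      unfolding set_encode_def by (rule sum_mono2) (use F in auto)
    also have "\<dots> = 2 ^ Suc ?m - 1" using sum_power2[of "Suc ?m"] unfolding set_encode_def atLeast0LessThan .
    also have "\<dots> < 2 ^ Suc ?m" by simp
    finally show ?thesis .
  qed
  moreover have "in_code ix k (set_encode F) = P k" if k: "k < 3" for k
  proof (intro ext)
    fix x y c
    show "in_code ix k (set_encode F) x y c = P k x y c"
    proof
      assume "in_code ix k (set_encode F) x y c"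
      then have c: "c \<in> Q" "fact_code ix k x y c \<in> F"
        unfolding in_code_def set_encode_inverse[OF fin] by blast+
      from c(2) obtain k' x' y' c' where z: "fact_code ix k x y c = fact_code ix k' x' y' c'" "P k' x' y' c'" 
        unfolding F_def by blast
      then show "P k x y c" using fact_code_eqD[OF z(1) ix c(1)] P[OF z(2)] k by blast
    next
      assume *: "P k x y c"
      then have "fact_code ix k x y c \<in> F" unfolding F_def by blast
      then show "in_code ix k (set_encode F) x y c"
        using P[OF *] unfolding in_code_def set_encode_inverse[OF fin] by blast
    qed
  qed
  ultimately show thesis by (rule that)
qed

text \<open>Among the sets quantified over is the set of true facts, and it is closed. Acceptance
  therefore puts the wanted fact among the true ones, which exhibits an accepted word.\<close>

lemma accepts_code_sound:
  assumes e: "inj_on e A" and K: "nfa_over A K" and w: "w \<in> lists A" 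
    and ix: "inj_on ix Q" and M: "\<And>c. c \<in> Q \<Longrightarrow> 3 * ix c + 2 \<le> M"
    and acc: "accepts_code e ix M (word_code e w) (nfa_code e K)"
  shows "val w \<in> val ` language K"
proof -
  let ?w = "word_code e w" and ?N = "nfa_code e K"
  let ?n = "Suc (?w + ?N)"
  let ?R1 = "word_edge e" and ?R2 = "nfa_edge e ?N"
  define P where "P k x y c \<longleftrightarrow> (k = 0 \<and> sound_word ?n ?R1 x y c) \<or> (k = 1 \<and> sound_word ?n ?R2 x y c) \<or>
    (k = 2 \<and> sound_pair ?n ?R1 ?R2 (code_final ?N) x y c)" for k :: nat and x y c
  have "c \<in> Q \<and> k < 3 \<and> x < ?n \<and> y < ?n" if "P k x y c" for k x y c
  proof -
    have "c \<in> Q" using that unfolding P_def sound_word_def sound_pair_def Q_def by blast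
    moreover have "k < 3" using that unfolding P_def by auto
    moreover have "x < ?n" using that gpath_bound unfolding P_def sound_word_def sound_pair_def by blast
    moreover have "y < ?n" using that gpath_bound unfolding P_def sound_word_def sound_pair_def by blast
    ultimately show ?thesis by blast
  qed
  from code_facts[OF ix M this] obtain S where 
    S: "S < 2 ^ Suc (prod_encode (M, prod_encode (?w + ?N, ?w + ?N)))" "\<And>k. k < 3 \<Longrightarrow> in_code ix k S = P k"
    by blast
  have PP: "P 0 = sound_word ?n ?R1" "P 1 = sound_word ?n ?R2" "P 2 = sound_pair ?n ?R1 ?R2 (code_final ?N)"
    unfolding P_def by auto
  have SS: "in_code ix 0 S = sound_word ?n ?R1" "in_code ix 1 S = sound_word ?n ?R2" 
    "in_code ix 2 S = sound_pair ?n ?R1 ?R2 (code_final ?N)"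
    unfolding PP[symmetric] by (rule S(2), simp)+
  have "closed_code e ix S ?w ?N"
    unfolding closed_code_def SS by (rule closed_facts_sound) simp
  then obtain p where p: "p < ?n" "code_initial ?N p" "in_code ix 2 S ?w p idm"
    using acc S(1) unfolding accepts_code_def by blast
  from p(3) obtain u v f where uv: "u \<in> lists A" "v \<in> lists A" "code_final ?N f" 
    "gpath ?n ?R1 ?w u 0" "gpath ?n ?R2 p v f" "val u = idm \<cdot> val v"
    unfolding SS sound_pair_def by blast
  \<comment> \<open>In the graph of the input word only the word itself labels a path from its code
    to 0.\<close>
  have "u = w" using word_code_inj[OF e w uv(1)] gpath_word_code_unique[OF uv(4)] by simp
  then have "val w = val v" using uv(6) val_closed[OF uv(2)] by simp
  moreover have "run K p v f" 
    using run_iff_gpath[OF e K _ uv(2), of ?n f p] uv(5) gpath_bound[OF uv(5)] by simp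
  then have "v \<in> language K"
    using p(2) uv(3) unfolding language_def code_initial_iff code_final_iff by blast
  ultimately show ?thesis by blast
qed

section \<open>The decision procedure and the choice of the set of units\<close>

lemma decidable: "rational_subset_membership_decidable A (special_rels W)"
  unfolding rational_subset_membership_decidable_def
proof (intro allI impI)
  fix e :: "'a \<Rightarrow> nat" assume e: "inj_on e A"
  \<comment> \<open>A numbering of \<open>Q\<close> by the numbers below \<open>m\<close>; then
    \<open>3 * m + 2\<close> bounds the first component of every fact code.\<close>
  obtain ix :: "'a list set \<Rightarrow> nat" and m where im: "ix ` Q = {i. i < m}" and ix: "inj_on ix Q"
    using finite_imp_inj_to_nat_seg[OF finite_Q] by blast
  have M: "3 * ix c + 2 \<le> 3 * m + 2" if "c \<in> Q" for c using imageI[OF that, of ix] im by simp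
  obtain f where f: "recursive 2 f" 
    "\<And>a b. f [a, b] = of_bool (accepts_code e ix (3 * m + 2) (case_nat a (\<lambda>_. b) 0) (case_nat a (\<lambda>_. b) (Suc 0)))"
    using recursive_2_of_computable[OF decid_accepts_code[of e ix "3 * m + 2"]] by blast
  have "f [word_code e w, nfa_code e K] = (if val w \<in> val ` language K then 1 else 0)" 
    if "w \<in> lists A" "nfa_over A K" for w K
  proof -
    have "accepts_code e ix (3 * m + 2) (word_code e w) (nfa_code e K) \<longleftrightarrow> val w \<in> val ` language K"
      using accepts_code_complete[OF e that(2,1)] accepts_code_sound[OF e that(2,1) ix M] by blast
    then show ?thesis unfolding f(2) by simp
  qed
  then show "\<exists>f. recursive 2 f \<and> (\<forall>w\<in>lists A. \<forall>K. nfa_over A K \<longrightarrow>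
      f [word_code e w, nfa_code e K] = (if val w \<in> val ` language K then 1 else 0))"
    using f(1) by blast
qed

end

text \<open>The splitting set is taken for the units with a representative in \<open>Omega\<close>
  and their inverses. These include the values of primes and their inverses, as
  \<open>split_presentation\<close> demands.\<close>

lemma (in special_presentation) decidable_of_virtually_free:
  assumes "virtually_free (units_of pm)"
  shows "rational_subset_membership_decidable A (special_rels W)"
proof -
  interpret M: monoid pm by (rule monoid_presented_monoid)
  interpret U: group "units_of pm" by (rule M.units_group)
  define S where "S = val ` Omega \<inter> Units pm"
  define S' where "S' = S \<union> uinv ` S"
  \<comment> \<open>Since a prime is good, it has the value of a word in the finite set
    \<open>Omega\<close>.\<close>
  have primes: "val p \<in> S" if p: "prime p" for p
  proof -
    obtain a z z' where z: "p = a # z" "z \<sim> z'" "a # z' \<in> Omega" using prime_good[OF p] unfolding good_def by blast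
    have "[a] \<sim> [a]" using prime_lists[OF that] z(1) by (auto intro: pres_cong.refl)
    then have "p \<sim> a # z'" using cong_append[OF _ z(2), of "[a]" "[a]"] z(1) by simp
    then have "val p = val (a # z')" using val_eq_iff cong_lists by blast
    then show ?thesis using z(3) prime_val_Units[OF that] unfolding S_def by auto
  qed
  have S: "finite S" "S \<subseteq> Units pm" unfolding S_def using finite_Omega by auto
  then have S': "finite S'" "S' \<subseteq> carrier (units_of pm)" 
    unfolding S'_def units_of_carrier using uinv(1) by auto
  from virtually_free_splitting_set[OF U.group_axioms assms S', unfolded units_of_mult units_of_one units_of_carrier]
  obtain B where *: "finite B \<and> S' \<subseteq> B \<and> idm \<in> B \<and> B \<subseteq> Units pm \<and> (\<forall>b\<in>B. uinv b \<in> B) \<and>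
    (\<forall>ss. set ss \<subseteq> S' \<longrightarrow> length ss \<ge> 2 \<longrightarrow> foldr (\<cdot>) ss idm \<in> B \<longrightarrow>
      (\<exists>xs ys. ss = xs @ ys \<and> xs \<noteq> [] \<and> ys \<noteq> [] \<and> foldr (\<cdot>) xs idm \<in> B \<and> foldr (\<cdot>) ys idm \<in> B))"
    by (elim exE)
  then have B: "finite B" "S' \<subseteq> B" "idm \<in> B" "B \<subseteq> Units pm" "\<And>b. b \<in> B \<Longrightarrow> uinv b \<in> B"
    by simp_all
  have split: "\<exists>xs ys. ss = xs @ ys \<and> xs \<noteq> [] \<and> ys \<noteq> [] \<and> foldr (\<cdot>) xs idm \<in> B \<and> foldr (\<cdot>) ys idm \<in> B"
    if "set ss \<subseteq> S'" "2 \<le> length ss" "foldr (\<cdot>) ss idm \<in> B" for ss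
    using * that by simp
  have pS: "val ` Collect prime \<union> uinv ` (val ` Collect prime) \<subseteq> S'"
    using primes unfolding S'_def by blast
  interpret split_presentation A W B
  proof
    show "val ` Omega \<inter> Units pm \<subseteq> B" using B(2) unfolding S'_def S_def by blast
    show "val p \<in> B" if "prime p" for p using primes[OF that] B(2) unfolding S'_def by blast
    show "\<exists>xs ys. ss = xs @ ys \<and> xs \<noteq> [] \<and> ys \<noteq> [] \<and> foldr (\<cdot>) xs idm \<in> B \<and> foldr (\<cdot>) ys idm \<in> B"
      if "set ss \<subseteq> val ` Collect prime \<union> uinv ` (val ` Collect prime)" "2 \<le> length ss"
        "foldr (\<cdot>) ss idm \<in> B" for ss
      using split[OF subset_trans[OF that(1) pS] that(2,3)] .
  qed (use B in blast)+
  show ?thesis by (rule decidable)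
qed

theorem theorem3p5:
  fixes A :: "'a set" and W :: "'a list set"
  assumes "finite A" and "finite W" and "W \<subseteq> lists A"
    and "virtually_free (units_of (presented_monoid A (special_rels W)))"
  shows "rational_subset_membership_decidable A (special_rels W)"
proof -
  interpret special_presentation A W by unfold_locales (fact assms)+
  show ?thesis using assms(4) by (rule decidable_of_virtually_free)
qed

end
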